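(* Let $A_0$ and $A_1$ be OPCAs that have a pseudoproduct in the preorder-enriched category $\mathsf{PCA}$. Then at least one of $A_0$ and $A_1$ is trivial.
   Context: The Axiom of Choice is assumed for sets. Partiality: for possibly undefined expressions, $e\downarrow$ means that $e$ (and all its subexpressions) is defined; $e'\preceq e$ means: if $e\downarrow$, then $e'\downarrow$ and $e'\leq e$; $e'\leq e$ means that both are defined and the inequality holds. Application associates to the left: $abc=(ab)c$; $a\cdot b$ also denotes $ab$. OPCAs: an ordered partial applicative structure (OPAS) is a poset $A$ with a partial binary map $A\times A\rightharpoonup A$, $(a,b)\mapsto ab$, such that if $a'\leq a$, $b'\leq b$ and $ab\downarrow$, then $a'b'\downarrow$ and $a'b'\leq ab$. An OPAS $A$ is an ordered partial combinatory algebra (OPCA) if there exist $\mathsf{k},\mathsf{s}\in A$ such that for all $a,b,c\in A$: $\mathsf{k}ab\leq a$; $\mathsf{s}ab\downarrow$; $\mathsf{s}abc\preceq ac(bc)$. Morphisms: a morphism of OPCAs $f\colon A\to B$ is a function for which there exist $t\in B$ (a tracker) with $t\cdot f(a)\cdot f(a')\preceq f(aa')$ for all $a,a'\in A$, and $u\in B$ with $u\cdot f(a')\leq f(a)$ whenever $a'\leq a$. For functions $f,f'\colon A\to B$, write $f\leq f'$ if there is $s\in B$ with $s\cdot f(a)\leq f'(a)$ for all $a\in A$; $f\simeq f'$ means $f\leq f'$ and $f'\leq f$. OPCAs, morphisms and these inequalities form the preorder-enriched category $\mathsf{OPCA}$ (composition of functions). Trivial OPCAs: an OPCA $A$ is trivial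 if it is equivalent in $\mathsf{OPCA}$ to the one-element OPCA $\mathbf{1}=\{*\}$ with $**=*$; equivalently, if $A$ has a least element. Applicative morphisms: for an OPCA $A$, $TA$ is the set of nonempty downsets of $A$, ordered by inclusion, with $\alpha\beta\downarrow$ iff $ab\downarrow$ for all $a\in\alpha$, $b\in\beta$, and then $\alpha\beta={\downarrow}\{ab\mid a\in\alpha,b\in\beta\}$ (here ${\downarrow}X$ is the downward closure of $X$). $TA$ is again an OPCA, and $\delta_A\colon A\to TA$, $\delta_A(a)={\downarrow}\{a\}$, is a morphism of OPCAs. The preorder-enriched category $\mathsf{PCA}$ has OPCAs as objects; an arrow $f\colon A\multimap B$ (an applicative morphism) is a morphism of OPCAs $f\colon A\to TB$, and $\mathsf{PCA}(A,B)$ has the preorder of $\mathsf{OPCA}(A,TB)$; the identity on $A$ is $\delta_A$; the composite of $f\colon A\multimap B$ and $g\colon B\multimap C$ is $(gf)(a)=\bigcup_{b\in f(a)}g(b)$, where this formula is understood as the downset $\bigcup\,{\downarrow}\{g(b)\mid b\in f(a)\}$. (This is the Kleisli category of the pseudomonad $T$.) A pseudoproduct of $A_0$ and $A_1$ in $\mathsf{PCA}$ is an OPCA $C$ with applicative morphisms $\sigma_i\colon C\multimap A_i$ ($i=0,1$) such that for every OPCA $B$ the monotone map $\mathsf{PCA}(B,C)\to\mathsf{PCA}(B,A_0)\times\mathsf{PCA}(B,A_1)$, $g\mapsto(\sigma_0g,\sigma_1g)$, is an equivalence of preorders (it reflects the order and is surjective up to $\simeq$). *)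

theory Defs
  imports Main
begin

section \<open>Ordered partial applicative structures\<close>

text \<open>The value \<^term>\<open>None\<close> of \<open>app\<close> stands for ``undefined''. Only the behaviour on the
  carrier is relevant.\<close>

record 'a opas =
  carrier :: "'a set"
  le :: "('a \<times> 'a) set"
  app :: "'a \<Rightarrow> 'a \<Rightarrow> 'a option"

text \<open>Possibly undefined expressions are terms of type \<open>'a option\<close>; an application is defined only
  if both of its subexpressions are.\<close>

definition pdefined :: "'a option \<Rightarrow> bool" where
  "pdefined e \<longleftrightarrow> e \<noteq> None"

definition papp :: "('a, 'm) opas_scheme \<Rightarrow> 'a option \<Rightarrow> 'a option \<Rightarrow> 'a option" where
  "papp A e e' = Option.bind e (\<lambda>a. Option.bind e' (\<lambda>b. app A a b))"

definition ple :: "('a, 'm) opas_scheme \<Rightarrow> 'a option \<Rightarrow> 'a option \<Rightarrow> bool" where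
  "ple A e' e \<longleftrightarrow> (\<exists>a' a. e' = Some a' \<and> e = Some a \<and> (a', a) \<in> le A)"

definition kle :: "('a, 'm) opas_scheme \<Rightarrow> 'a option \<Rightarrow> 'a option \<Rightarrow> bool" where
  "kle A e' e \<longleftrightarrow> (pdefined e \<longrightarrow> pdefined e' \<and> ple A e' e)"

definition opas :: "('a, 'm) opas_scheme \<Rightarrow> bool" where
  "opas A \<longleftrightarrow>
     partial_order_on (carrier A) (le A) \<and>
     (\<forall>a\<in>carrier A. \<forall>b\<in>carrier A. \<forall>c. app A a b = Some c \<longrightarrow> c \<in> carrier A) \<and>
     (\<forall>a a' b b'. (a', a) \<in> le A \<and> (b', b) \<in> le A \<and> pdefined (app A a b) \<longrightarrow>
        pdefined (app A a' b') \<and> ple A (app A a' b') (app A a b))"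

definition opca :: "('a, 'm) opas_scheme \<Rightarrow> bool" where
  "opca A \<longleftrightarrow> opas A \<and>
     (\<exists>k\<in>carrier A. \<exists>s\<in>carrier A. \<forall>a\<in>carrier A. \<forall>b\<in>carrier A. \<forall>c\<in>carrier A.
        ple A (papp A (papp A (Some k) (Some a)) (Some b)) (Some a) \<and>
        pdefined (papp A (papp A (Some s) (Some a)) (Some b)) \<and>
        kle A (papp A (papp A (papp A (Some s) (Some a)) (Some b)) (Some c))
              (papp A (papp A (Some a) (Some c)) (papp A (Some b) (Some c))))"


section \<open>The preorder-enriched category of OPCAs\<close>

definition opca_morphism ::
    "('a, 'm) opas_scheme \<Rightarrow> ('b, 'n) opas_scheme \<Rightarrow> ('a \<Rightarrow> 'b) \<Rightarrow> bool" where
  "opca_morphism A B f \<longleftrightarrow>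
     (\<forall>a\<in>carrier A. f a \<in> carrier B) \<and>
     (\<exists>t\<in>carrier B. \<forall>a\<in>carrier A. \<forall>a'\<in>carrier A.
        kle B (papp B (papp B (Some t) (Some (f a))) (Some (f a'))) (map_option f (app A a a'))) \<and>
     (\<exists>u\<in>carrier B. \<forall>a\<in>carrier A. \<forall>a'\<in>carrier A.
        (a', a) \<in> le A \<longrightarrow> ple B (papp B (Some u) (Some (f a'))) (Some (f a)))"

definition opca_le ::
    "('a, 'm) opas_scheme \<Rightarrow> ('b, 'n) opas_scheme \<Rightarrow> ('a \<Rightarrow> 'b) \<Rightarrow> ('a \<Rightarrow> 'b) \<Rightarrow> bool" where
  "opca_le A B f f' \<longleftrightarrow>
     (\<exists>s\<in>carrier B. \<forall>a\<in>carrier A. ple B (papp B (Some s) (Some (f a))) (Some (f' a)))"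

definition opca_simeq ::
    "('a, 'm) opas_scheme \<Rightarrow> ('b, 'n) opas_scheme \<Rightarrow> ('a \<Rightarrow> 'b) \<Rightarrow> ('a \<Rightarrow> 'b) \<Rightarrow> bool" where
  "opca_simeq A B f f' \<longleftrightarrow> opca_le A B f f' \<and> opca_le A B f' f"

definition opca_equivalent :: "('a, 'm) opas_scheme \<Rightarrow> ('b, 'n) opas_scheme \<Rightarrow> bool" where
  "opca_equivalent A B \<longleftrightarrow>
     (\<exists>f g. opca_morphism A B f \<and> opca_morphism B A g \<and>
        opca_simeq A A (g \<circ> f) id \<and> opca_simeq B B (f \<circ> g) id)"

definition one_opca :: "unit opas" where
  "one_opca = \<lparr>carrier = UNIV, le = UNIV, app = (\<lambda>_ _. Some ())\<rparr>"

definition trivial_opca :: "('a, 'm) opas_scheme \<Rightarrow> bool" where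
  "trivial_opca A \<longleftrightarrow> opca_equivalent A one_opca"


section \<open>Downsets and applicative morphisms\<close>

definition down :: "('a, 'm) opas_scheme \<Rightarrow> 'a set \<Rightarrow> 'a set" where
  "down A X = {a. \<exists>x\<in>X. (a, x) \<in> le A}"

definition ne_downsets :: "('a, 'm) opas_scheme \<Rightarrow> 'a set set" where
  "ne_downsets A = {\<alpha>. \<alpha> \<noteq> {} \<and> \<alpha> \<subseteq> carrier A \<and> (\<forall>a\<in>\<alpha>. \<forall>a'. (a', a) \<in> le A \<longrightarrow> a' \<in> \<alpha>)}"

definition T_opca :: "('a, 'm) opas_scheme \<Rightarrow> 'a set opas" where
  "T_opca A =
     \<lparr>carrier = ne_downsets A,
      le = {(\<alpha>, \<beta>). \<alpha> \<in> ne_downsets A \<and> \<beta> \<in> ne_downsets A \<and> \<alpha> \<subseteq> \<beta>},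
      app = (\<lambda>\<alpha> \<beta>. if \<forall>a\<in>\<alpha>. \<forall>b\<in>\<beta>. pdefined (app A a b)
                   then Some (down A {c. \<exists>a\<in>\<alpha>. \<exists>b\<in>\<beta>. app A a b = Some c})
                   else None)\<rparr>"

definition pca_arrow ::
    "('a, 'm) opas_scheme \<Rightarrow> ('b, 'n) opas_scheme \<Rightarrow> ('a \<Rightarrow> 'b set) \<Rightarrow> bool" where
  "pca_arrow A B f \<longleftrightarrow> opca_morphism A (T_opca B) f"

definition pca_le ::
    "('a, 'm) opas_scheme \<Rightarrow> ('b, 'n) opas_scheme \<Rightarrow> ('a \<Rightarrow> 'b set) \<Rightarrow> ('a \<Rightarrow> 'b set) \<Rightarrow> bool" where
  "pca_le A B f f' \<longleftrightarrow> opca_le A (T_opca B) f f'"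

definition pca_simeq ::
    "('a, 'm) opas_scheme \<Rightarrow> ('b, 'n) opas_scheme \<Rightarrow> ('a \<Rightarrow> 'b set) \<Rightarrow> ('a \<Rightarrow> 'b set) \<Rightarrow> bool" where
  "pca_simeq A B f f' \<longleftrightarrow> pca_le A B f f' \<and> pca_le A B f' f"

text \<open>The downward closure below is taken in \<open>T_opca C\<close>, where \<open>C\<close> is the codomain of \<open>g\<close>.\<close>

definition pca_comp ::
    "('c, 'm) opas_scheme \<Rightarrow> ('b \<Rightarrow> 'c set) \<Rightarrow> ('a \<Rightarrow> 'b set) \<Rightarrow> 'a \<Rightarrow> 'c set" where
  "pca_comp C g f = (\<lambda>a. \<Union> (down (T_opca C) (g ` f a)))"


section \<open>Pseudoproducts\<close>

text \<open>The type \<open>'u\<close> plays the role of the universe of sets: the objects of the category are the OPCAs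
  whose carrier is a subset of \<open>'u\<close>, so the test objects \<open>B\<close> range over the same OPCAs
  as \<open>A0\<close>, \<open>A1\<close> and \<open>C\<close>.\<close>

definition is_pseudoproduct ::
    "'u opas \<Rightarrow> 'u opas \<Rightarrow> 'u opas \<Rightarrow> ('u \<Rightarrow> 'u set) \<Rightarrow> ('u \<Rightarrow> 'u set) \<Rightarrow> bool" where
  "is_pseudoproduct A0 A1 C \<sigma>0 \<sigma>1 \<longleftrightarrow>
     opca C \<and> pca_arrow C A0 \<sigma>0 \<and> pca_arrow C A1 \<sigma>1 \<and>
     (\<forall>B :: 'u opas. opca B \<longrightarrow>
        (\<forall>g g'. pca_arrow B C g \<and> pca_arrow B C g' \<and>
            pca_le B A0 (pca_comp A0 \<sigma>0 g) (pca_comp A0 \<sigma>0 g') \<and>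
            pca_le B A1 (pca_comp A1 \<sigma>1 g) (pca_comp A1 \<sigma>1 g') \<longrightarrow>
            pca_le B C g g') \<and>
        (\<forall>f0 f1. pca_arrow B A0 f0 \<and> pca_arrow B A1 f1 \<longrightarrow>
            (\<exists>g. pca_arrow B C g \<and>
               pca_simeq B A0 (pca_comp A0 \<sigma>0 g) f0 \<and>
               pca_simeq B A1 (pca_comp A1 \<sigma>1 g) f1)))"

definition has_pseudoproduct :: "'u opas \<Rightarrow> 'u opas \<Rightarrow> bool" where
  "has_pseudoproduct A0 A1 \<longleftrightarrow> (\<exists>C \<sigma>0 \<sigma>1. is_pseudoproduct A0 A1 C \<sigma>0 \<sigma>1)"

end

theory Submission
  imports Defs
begin

text \<open>
  Suppose that \<open>A0\<close> and \<open>A1\<close> have a pseudoproduct \<open>C\<close>, with projections \<open>\<sigma>0\<close> and \<open>\<sigma>1\<close>, and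
  that neither of them has a least element. An applicative morphism into \<open>C\<close> is determined up to
  \<open>\<simeq>\<close> by its two projections, and projections cannot tell a downset of \<open>A0 \<times> A1\<close> from the smallest
  rectangle \<open>hull \<alpha>\<close> that contains it. A single test object \<open>B\<close> turns this into a contradiction.

  The elements of \<open>B\<close> are downsets of \<open>P = A0 \<times> A1\<close>, multiplied as in \<open>T P\<close>. Among them are the
  principal downsets and, for each \<open>d\<close>, the downset \<open>avoiding P (principal P d)\<close> of the elements
  that are not above \<open>d\<close>. As neither \<open>A0\<close> nor \<open>A1\<close> has a least element, the hull of the latter is all
  of \<open>P\<close>, whatever \<open>d\<close> is. The two images of a downset are applicative morphisms from \<open>B\<close> to \<open>A0\<close>
  and \<open>A1\<close>; let \<open>q\<close> from \<open>B\<close> to \<open>C\<close> be a mediating morphism. Then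
    \<open>g1 \<alpha> = q (hull \<alpha>)\<close> and \<open>g2 \<alpha> = (\<Union>a\<in>\<alpha>. q (principal P a))\<close>
  are applicative morphisms as well, and both have the same projections as \<open>q\<close> up to \<open>\<simeq>\<close>. The
  inequality between the projections of \<open>g1\<close> and those of \<open>g2\<close>, which is the one that matters, is
  \<open>projection_le_via_principals\<close>. Since projections reflect the order, some \<open>w\<close> in \<open>C\<close> realizes \<open>g1 \<le> g2\<close>.

  Take \<open>e \<in> q P\<close>. Since \<open>P\<close> is the hull of every \<open>avoiding P (principal P d)\<close>, the one element
  \<open>e' = w e\<close> must, for every \<open>d\<close>, lie in \<open>q (principal P a)\<close> for some \<open>a\<close> that is not above \<open>d\<close>. But
  \<open>e'\<close> also determines a lower bound of all these \<open>a\<close>: choose \<open>ci \<in> \<sigma>i e'\<close>, and let \<open>ri\<close> realize the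
  comparison of \<open>\<sigma>i q\<close> with the image maps; then \<open>(r0 c0, r1 c1) \<le> a\<close> whenever
  \<open>e' \<in> q (principal P a)\<close>. With \<open>d = (r0 c0, r1 c1)\<close> this is absurd
  (\<open>no_pseudoproduct_without_least\<close>).

  It remains to find \<open>B\<close> among the OPCAs whose elements belong to the type \<open>'u\<close>. If \<open>'u\<close> is infinite,
  then the required downsets are the values of terms over \<open>'u \<times> 'u\<close>, so there are no more of them
  than elements of \<open>'u\<close> (\<open>ex_inj_on_test_downsets\<close>), and the OPCA structure is transported along an
  injection (\<open>relabel\<close>). If \<open>'u\<close> is finite, then \<open>A0\<close> is finite, and a finite OPCA has a least element
  (\<open>finite_opca_has_least\<close>). Finally, an OPCA with a least element is trivial
  (\<open>trivial_opca_if_least\<close>).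
\<close>

section \<open>Ordered applicative structures, elementwise\<close>

lemma opas_le_carrier:
  assumes "opas A" and "(a, b) \<in> le A"
  shows "a \<in> carrier A" and "b \<in> carrier A"
  using assms
  by (auto simp: opas_def partial_order_on_def preorder_on_def)

lemma opas_refl: "opas A \<Longrightarrow> a \<in> carrier A \<Longrightarrow> (a, a) \<in> le A"
  by (auto simp: opas_def partial_order_on_def preorder_on_def refl_on_def)

lemma opas_trans: "opas A \<Longrightarrow> (a, b) \<in> le A \<Longrightarrow> (b, c) \<in> le A \<Longrightarrow> (a, c) \<in> le A"
  unfolding opas_def partial_order_on_def preorder_on_def by (meson transD)

lemma opas_antisym: "opas A \<Longrightarrow> (a, b) \<in> le A \<Longrightarrow> (b, a) \<in> le A \<Longrightarrow> a = b"
  unfolding opas_def partial_order_on_def by (meson antisymD)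

lemma opas_app_closed:
  "opas A \<Longrightarrow> a \<in> carrier A \<Longrightarrow> b \<in> carrier A \<Longrightarrow> app A a b = Some c \<Longrightarrow> c \<in> carrier A"
  unfolding opas_def by blast

lemma opas_app_mono:
  assumes "opas A" and "app A a b = Some c" and "(a', a) \<in> le A" and "(b', b) \<in> le A"
  shows "\<exists>c'. app A a' b' = Some c' \<and> (c', c) \<in> le A"
proof -
  have "pdefined (app A a b)"
    using assms(2) by (simp add: pdefined_def)
  then have "ple A (app A a' b') (app A a b)"
    using assms(1,3,4) unfolding opas_def by blast
  then show ?thesis
    using assms(2) by (auto simp: ple_def)
qed

lemma opasI:
  assumes "le A \<subseteq> carrier A \<times> carrier A"
    and "\<And>a. a \<in> carrier A \<Longrightarrow> (a, a) \<in> le A"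
    and "\<And>a b c. (a, b) \<in> le A \<Longrightarrow> (b, c) \<in> le A \<Longrightarrow> (a, c) \<in> le A"
    and "\<And>a b. (a, b) \<in> le A \<Longrightarrow> (b, a) \<in> le A \<Longrightarrow> a = b"
    and "\<And>a b c. a \<in> carrier A \<Longrightarrow> b \<in> carrier A \<Longrightarrow> app A a b = Some c \<Longrightarrow> c \<in> carrier A"
    and "\<And>a a' b b' c. (a', a) \<in> le A \<Longrightarrow> (b', b) \<in> le A \<Longrightarrow> app A a b = Some c \<Longrightarrow>
      \<exists>c'. app A a' b' = Some c' \<and> (c', c) \<in> le A"
  shows "opas A"
proof -
  have "partial_order_on (carrier A) (le A)"
    unfolding partial_order_on_def preorder_on_def
    using assms(1-4) by (auto intro!: refl_onI transI antisymI)
  moreover have "pdefined (app A a' b') \<and> ple A (app A a' b') (app A a b)"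
    if "(a', a) \<in> le A" "(b', b) \<in> le A" "pdefined (app A a b)" for a a' b b'
    using assms(6)[OF that(1,2)] that(3) by (auto simp: pdefined_def ple_def)
  ultimately show ?thesis
    using assms(5) unfolding opas_def by blast
qed

definition app_in :: "('a, 'm) opas_scheme \<Rightarrow> 'a \<Rightarrow> 'a \<Rightarrow> 'a set \<Rightarrow> bool" where
  "app_in A u v S \<longleftrightarrow> (\<exists>y. app A u v = Some y \<and> y \<in> S)"

lemma app_in_weaken: "app_in A u v S \<Longrightarrow> S \<subseteq> S' \<Longrightarrow> app_in A u v S'"
  by (auto simp: app_in_def)

lemma app_in_mono:
  assumes "opas A" and "app_in A u v S" and "S \<in> ne_downsets A"
    and "(u', u) \<in> le A" and "(v', v) \<in> le A"
  shows "app_in A u' v' S"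
  using assms opas_app_mono[OF assms(1) _ assms(4,5)]
  by (fastforce simp: app_in_def ne_downsets_def)

text \<open>The axioms for \<open>k\<close> and \<open>s\<close> with every intermediate value named, so that no partial expressions
  remain.\<close>

definition combinators :: "('a, 'm) opas_scheme \<Rightarrow> 'a \<Rightarrow> 'a \<Rightarrow> bool" where
  "combinators A k s \<longleftrightarrow> k \<in> carrier A \<and> s \<in> carrier A \<and>
     (\<forall>a\<in>carrier A. \<forall>b\<in>carrier A. \<exists>ka y.
        app A k a = Some ka \<and> app A ka b = Some y \<and> (y, a) \<in> le A) \<and>
     (\<forall>a\<in>carrier A. \<forall>b\<in>carrier A. \<exists>sa sab.
        app A s a = Some sa \<and> app A sa b = Some sab \<and>
        (\<forall>c\<in>carrier A. \<forall>ac bc d. app A a c = Some ac \<longrightarrow> app A b c = Some bc \<longrightarrow>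
           app A ac bc = Some d \<longrightarrow> (\<exists>y. app A sab c = Some y \<and> (y, d) \<in> le A)))"

lemma opca_iff_combinators: "opca A \<longleftrightarrow> opas A \<and> (\<exists>k s. combinators A k s)"
proof (cases "carrier A = {}")
  case True
  then show ?thesis
    by (auto simp: opca_def combinators_def)
next
  case False
  have "(\<forall>a\<in>carrier A. \<forall>b\<in>carrier A. \<forall>c\<in>carrier A.
        ple A (papp A (papp A (Some k) (Some a)) (Some b)) (Some a) \<and>
        pdefined (papp A (papp A (Some s) (Some a)) (Some b)) \<and>
        kle A (papp A (papp A (papp A (Some s) (Some a)) (Some b)) (Some c))
              (papp A (papp A (Some a) (Some c)) (papp A (Some b) (Some c))))
     \<longleftrightarrow> (\<forall>a\<in>carrier A. \<forall>b\<in>carrier A. \<exists>ka y.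
        app A k a = Some ka \<and> app A ka b = Some y \<and> (y, a) \<in> le A) \<and>
     (\<forall>a\<in>carrier A. \<forall>b\<in>carrier A. \<exists>sa sab.
        app A s a = Some sa \<and> app A sa b = Some sab \<and>
        (\<forall>c\<in>carrier A. \<forall>ac bc d. app A a c = Some ac \<longrightarrow> app A b c = Some bc \<longrightarrow>
           app A ac bc = Some d \<longrightarrow> (\<exists>y. app A sab c = Some y \<and> (y, d) \<in> le A)))"
    (is "?L \<longleftrightarrow> ?K \<and> ?S") for k s
  proof
    assume L: ?L
    have ?K
    proof (intro ballI)
      fix a b assume "a \<in> carrier A" "b \<in> carrier A"
      with L have "ple A (papp A (papp A (Some k) (Some a)) (Some b)) (Some a)" by blast
      then show "\<exists>ka y. app A k a = Some ka \<and> app A ka b = Some y \<and> (y, a) \<in> le A"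
        by (auto simp: ple_def papp_def bind_eq_Some_conv)
    qed
    moreover have ?S
    proof (intro ballI)
      fix a b assume ab: "a \<in> carrier A" "b \<in> carrier A"
      with False L have "pdefined (papp A (papp A (Some s) (Some a)) (Some b))" by blast
      then obtain sa sab where s: "app A s a = Some sa" "app A sa b = Some sab"
        by (auto simp: pdefined_def papp_def bind_eq_Some_conv)
      have "\<exists>y. app A sab c = Some y \<and> (y, d) \<in> le A"
        if "c \<in> carrier A" "app A a c = Some ac" "app A b c = Some bc" "app A ac bc = Some d"
        for c ac bc d
      proof -
        have "kle A (papp A (papp A (papp A (Some s) (Some a)) (Some b)) (Some c))
              (papp A (papp A (Some a) (Some c)) (papp A (Some b) (Some c)))"
          using L ab that(1) by blast
        then show ?thesis
          using s that by (auto simp: kle_def ple_def papp_def pdefined_def)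
      qed
      then show "\<exists>sa sab. app A s a = Some sa \<and> app A sa b = Some sab \<and>
        (\<forall>c\<in>carrier A. \<forall>ac bc d. app A a c = Some ac \<longrightarrow> app A b c = Some bc \<longrightarrow>
           app A ac bc = Some d \<longrightarrow> (\<exists>y. app A sab c = Some y \<and> (y, d) \<in> le A))"
        using s by blast
    qed
    ultimately show "?K \<and> ?S" ..
  next
    assume R: "?K \<and> ?S"
    show ?L
    proof (intro ballI conjI)
      fix a b c assume abc: "a \<in> carrier A" "b \<in> carrier A" "c \<in> carrier A"
      show "ple A (papp A (papp A (Some k) (Some a)) (Some b)) (Some a)"
        using R abc(1,2) by (fastforce simp: ple_def papp_def)
      obtain sa sab where s: "app A s a = Some sa" "app A sa b = Some sab"
        and sc: "\<And>ac bc d. app A a c = Some ac \<Longrightarrow> app A b c = Some bc \<Longrightarrow>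
           app A ac bc = Some d \<Longrightarrow> \<exists>y. app A sab c = Some y \<and> (y, d) \<in> le A"
        using R abc by meson
      show "pdefined (papp A (papp A (Some s) (Some a)) (Some b))"
        using s by (simp add: pdefined_def papp_def)
      show "kle A (papp A (papp A (papp A (Some s) (Some a)) (Some b)) (Some c))
              (papp A (papp A (Some a) (Some c)) (papp A (Some b) (Some c)))"
        using s sc by (fastforce simp: kle_def ple_def papp_def pdefined_def bind_eq_Some_conv)
    qed
  qed
  note eq = this
  show ?thesis
    unfolding opca_def combinators_def eq by (simp only: Bex_def conj_assoc ex_simps)
qed

lemma combinators_S:
  assumes "combinators A k s" and "a \<in> carrier A" and "b \<in> carrier A"
  obtains sa sab where "app A s a = Some sa" and "app A sa b = Some sab"
    and "\<And>c ac bc d. c \<in> carrier A \<Longrightarrow> app A a c = Some ac \<Longrightarrow> app A b c = Some bc \<Longrightarrow>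
      app A ac bc = Some d \<Longrightarrow> \<exists>y. app A sab c = Some y \<and> (y, d) \<in> le A"
proof -
  have "\<exists>sa sab. app A s a = Some sa \<and> app A sa b = Some sab \<and>
        (\<forall>c\<in>carrier A. \<forall>ac bc d. app A a c = Some ac \<longrightarrow> app A b c = Some bc \<longrightarrow>
           app A ac bc = Some d \<longrightarrow> (\<exists>y. app A sab c = Some y \<and> (y, d) \<in> le A))"
    using assms unfolding combinators_def by simp
  then show ?thesis using that by blast
qed

lemma opca_opas: "opca A \<Longrightarrow> opas A"
  by (simp add: opca_def)

lemma opca_K:
  assumes "opca A"
  obtains k where "k \<in> carrier A"
    and "\<And>a b. a \<in> carrier A \<Longrightarrow> b \<in> carrier A \<Longrightarrow>
      \<exists>ka y. app A k a = Some ka \<and> app A ka b = Some y \<and> (y, a) \<in> le A"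
  using assms unfolding opca_iff_combinators combinators_def by blast

text \<open>The element \<open>m = s (k r') r\<close> realizes the composite of two realizers.\<close>

lemma opca_composite:
  assumes "opca A" and "r \<in> carrier A" and "r' \<in> carrier A"
  shows "\<exists>m\<in>carrier A. \<forall>x\<in>carrier A. \<forall>y z. app A r x = Some y \<longrightarrow> app A r' y = Some z \<longrightarrow>
    (\<exists>z'. app A m x = Some z' \<and> (z', z) \<in> le A)"
proof -
  from assms(1) obtain k s where A: "opas A" and ks: "combinators A k s"
    by (auto simp: opca_iff_combinators)
  note carr = opas_app_closed[OF A]
  have K: "\<And>a b. a \<in> carrier A \<Longrightarrow> b \<in> carrier A \<Longrightarrow>
      \<exists>ka y. app A k a = Some ka \<and> app A ka b = Some y \<and> (y, a) \<in> le A"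
    and kc: "k \<in> carrier A" "s \<in> carrier A"
    using ks by (auto simp: combinators_def)
  obtain kr where kr: "app A k r' = Some kr" using K[OF assms(3,3)] by blast
  have krc: "kr \<in> carrier A" using carr[OF kc(1) assms(3) kr] .
  obtain sa m where m: "app A s kr = Some sa" "app A sa r = Some m"
    "\<And>c ac bc d. c \<in> carrier A \<Longrightarrow> app A kr c = Some ac \<Longrightarrow> app A r c = Some bc \<Longrightarrow>
      app A ac bc = Some d \<Longrightarrow> \<exists>y. app A m c = Some y \<and> (y, d) \<in> le A"
    by (rule combinators_S[OF ks krc assms(2)]) blast
  have mc: "m \<in> carrier A" using carr m(1,2) krc kc assms(2) by blast
  moreover have "\<exists>z'. app A m x = Some z' \<and> (z', z) \<in> le A"
    if x: "x \<in> carrier A" and y: "app A r x = Some y" and z: "app A r' y = Some z" for x y z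
  proof -
    obtain r'' where r'': "app A kr x = Some r''" "(r'', r') \<in> le A"
      using K[OF assms(3) x] kr by auto
    have "(y, y) \<in> le A" using carr[OF assms(2) x y] opas_refl[OF A] by blast
    then obtain w where w: "app A r'' y = Some w" "(w, z) \<in> le A"
      using opas_app_mono[OF A z r''(2)] by blast
    then obtain z' where "app A m x = Some z'" "(z', w) \<in> le A"
      using m(3)[OF x r''(1) y w(1)] by blast
    then show ?thesis using w(2) opas_trans[OF A] by blast
  qed
  ultimately show ?thesis by blast
qed

lemma opca_identity:
  assumes "opca A"
  obtains i where "i \<in> carrier A"
    and "\<And>x. x \<in> carrier A \<Longrightarrow> \<exists>y. app A i x = Some y \<and> (y, x) \<in> le A"
proof -
  from assms obtain k s where A: "opas A" and ks: "combinators A k s"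
    by (auto simp: opca_iff_combinators)
  note carr = opas_app_closed[OF A]
  have K: "\<And>a b. a \<in> carrier A \<Longrightarrow> b \<in> carrier A \<Longrightarrow>
      \<exists>ka y. app A k a = Some ka \<and> app A ka b = Some y \<and> (y, a) \<in> le A"
    and kc: "k \<in> carrier A" "s \<in> carrier A"
    using ks by (auto simp: combinators_def)
  obtain sk i where i: "app A s k = Some sk" "app A sk k = Some i"
    "\<And>c ac bc d. c \<in> carrier A \<Longrightarrow> app A k c = Some ac \<Longrightarrow> app A k c = Some bc \<Longrightarrow>
      app A ac bc = Some d \<Longrightarrow> \<exists>y. app A i c = Some y \<and> (y, d) \<in> le A"
    by (rule combinators_S[OF ks kc(1) kc(1)]) blast
  have "i \<in> carrier A" using carr i(1,2) kc by blast
  moreover have "\<exists>y. app A i x = Some y \<and> (y, x) \<in> le A" if x: "x \<in> carrier A" for x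
  proof -
    obtain kx where kx: "app A k x = Some kx" using K[OF x x] by blast
    then obtain d where d: "app A kx kx = Some d" "(d, x) \<in> le A"
      using K[OF x carr[OF kc(1) x kx]] by auto
    then show ?thesis using i(3)[OF x kx kx d(1)] d(2) opas_trans[OF A] by blast
  qed
  ultimately show ?thesis using that by blast
qed

text \<open>If \<open>z\<close> is least, then \<open>k z\<close> maps every element to something below \<open>z\<close>, hence below every
  element. It therefore realizes every inequality between functions into \<open>A\<close>.\<close>

lemma trivial_opca_if_least:
  assumes "opca A" and bot: "z \<in> carrier A" "\<And>a. a \<in> carrier A \<Longrightarrow> (z, a) \<in> le A"
  shows "trivial_opca A"
proof -
  note A = opca_opas[OF assms(1)]
  obtain k where k: "k \<in> carrier A" and K: "\<And>a b. a \<in> carrier A \<Longrightarrow> b \<in> carrier A \<Longrightarrow>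
      \<exists>ka y. app A k a = Some ka \<and> app A ka b = Some y \<and> (y, a) \<in> le A"
    by (rule opca_K[OF assms(1)]) blast
  obtain kz where kz: "app A k z = Some kz" using K[OF bot(1) bot(1)] by blast
  have kzc: "kz \<in> carrier A" using opas_app_closed[OF A k bot(1) kz] .
  have const: "\<exists>y. app A kz a = Some y \<and> (y, z) \<in> le A" if "a \<in> carrier A" for a
    using K[OF bot(1) that] kz by auto
  have const': "\<exists>y. app A kz a = Some y \<and> (y, b) \<in> le A"
    if "a \<in> carrier A" "b \<in> carrier A" for a b
    using const[OF that(1)] bot(2)[OF that(2)] opas_trans[OF A] by blast
  let ?f = "\<lambda>_. ()" and ?g = "\<lambda>_. z"
  have "opca_morphism A one_opca ?f"
    by (auto simp: opca_morphism_def one_opca_def kle_def ple_def papp_def pdefined_def)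
  moreover have "opca_morphism one_opca A ?g"
    unfolding opca_morphism_def
  proof (intro conjI)
    show "\<exists>t\<in>carrier A. \<forall>a\<in>carrier one_opca. \<forall>a'\<in>carrier one_opca.
        kle A (papp A (papp A (Some t) (Some z)) (Some z)) (map_option ?g (app one_opca a a'))"
      using k K[OF bot(1) bot(1)]
      by (intro bexI[of _ k]) (auto simp: one_opca_def kle_def ple_def papp_def pdefined_def)
    show "\<exists>u\<in>carrier A. \<forall>a\<in>carrier one_opca. \<forall>a'\<in>carrier one_opca.
        (a', a) \<in> le one_opca \<longrightarrow> ple A (papp A (Some u) (Some z)) (Some z)"
      using kzc const[OF bot(1)]
      by (intro bexI[of _ kz]) (auto simp: ple_def papp_def)
  qed (use bot in auto)
  moreover have "opca_simeq A A (?g \<circ> ?f) id"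
    unfolding opca_simeq_def opca_le_def
    using kzc const const'[OF bot(1)]
    by (intro conjI bexI[of _ kz]) (auto simp: ple_def papp_def)
  moreover have "opca_simeq one_opca one_opca (?f \<circ> ?g) id"
    by (auto simp: opca_simeq_def opca_le_def one_opca_def ple_def papp_def)
  ultimately show ?thesis
    unfolding trivial_opca_def opca_equivalent_def by blast
qed

section \<open>Finite OPCAs\<close>

text \<open>Write \<open>M\<close> for the set of minimal elements. For \<open>a \<in> M\<close>, a minimal element below \<open>k a\<close> is a constant
  function with value \<open>a\<close>, because its values lie below the minimal element \<open>a\<close>. This gives an injection from the finite set
  \<open>M\<close> to itself, so every element of \<open>M\<close> is a constant function. Apply this to a minimal element \<open>m\<close>
  below \<open>k\<close>: if \<open>m x = a\<close> for all \<open>x\<close>, then \<open>a a \<le> k x a \<le> x\<close> for all \<open>x\<close>.\<close>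

lemma finite_opca_has_least:
  assumes "opca A" and fin: "finite (carrier A)"
  shows "\<exists>z\<in>carrier A. \<forall>a\<in>carrier A. (z, a) \<in> le A"
proof -
  note A = opca_opas[OF assms(1)]
  note carr = opas_app_closed[OF A]
  obtain k where k: "k \<in> carrier A" and K: "\<And>a b. a \<in> carrier A \<Longrightarrow> b \<in> carrier A \<Longrightarrow>
      \<exists>ka y. app A k a = Some ka \<and> app A ka b = Some y \<and> (y, a) \<in> le A"
    by (rule opca_K[OF assms(1)]) blast
  define M where "M = {m \<in> carrier A. \<forall>x. (x, m) \<in> le A \<longrightarrow> x = m}"
  have below: "\<exists>m\<in>M. (m, x) \<in> le A" if "x \<in> carrier A" for x
    using that
  proof (induction "card {y. (y, x) \<in> le A}" arbitrary: x rule: less_induct)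
    case less
    show ?case
    proof (cases "x \<in> M")
      case True
      then show ?thesis using opas_refl[OF A less.prems] by blast
    next
      case False
      then obtain y where y: "(y, x) \<in> le A" "y \<noteq> x"
        using less.prems by (auto simp: M_def)
      have "{w. (w, y) \<in> le A} \<subset> {w. (w, x) \<in> le A}"
        using y opas_trans[OF A] opas_antisym[OF A] opas_refl[OF A less.prems] by blast
      moreover have "finite {w. (w, x) \<in> le A}"
        using opas_le_carrier(1)[OF A] by (auto intro: finite_subset[OF _ fin])
      ultimately have "card {w. (w, y) \<in> le A} < card {w. (w, x) \<in> le A}"
        by (simp add: psubset_card_mono)
      from less.hyps[OF this opas_le_carrier(1)[OF A y(1)]] y(1) opas_trans[OF A]
      show ?thesis by blast
    qed
  qed
  have "\<exists>m\<in>M. \<forall>b\<in>carrier A. app A m b = Some a" if a: "a \<in> M" for a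
  proof -
    have ac: "a \<in> carrier A" using a by (simp add: M_def)
    obtain ka where ka: "app A k a = Some ka" using K[OF ac ac] by blast
    obtain m where m: "m \<in> M" "(m, ka) \<in> le A" using below[OF carr[OF k ac ka]] by blast
    have "app A m b = Some a" if b: "b \<in> carrier A" for b
    proof -
      obtain y where y: "app A ka b = Some y" "(y, a) \<in> le A" using K[OF ac b] ka by auto
      obtain y' where "app A m b = Some y'" "(y', y) \<in> le A"
        using opas_app_mono[OF A y(1) m(2) opas_refl[OF A b]] by blast
      then show ?thesis using y(2) opas_trans[OF A] a by (auto simp: M_def)
    qed
    then show ?thesis using m(1) by blast
  qed
  then obtain c where c: "\<And>a. a \<in> M \<Longrightarrow> c a \<in> M"
    and c_app: "\<And>a b. a \<in> M \<Longrightarrow> b \<in> carrier A \<Longrightarrow> app A (c a) b = Some a"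
    by metis
  have "inj_on c M"
    using c_app k by (intro inj_onI) (metis option.inject)
  moreover have "finite M" using fin by (simp add: M_def)
  ultimately have surj: "c ` M = M"
    using c by (intro endo_inj_surj) auto
  obtain m where m: "m \<in> M" "(m, k) \<in> le A" using below[OF k] by blast
  then obtain a where a: "a \<in> M" "m = c a" using surj by blast
  have ac: "a \<in> carrier A" using a by (simp add: M_def)
  have "\<exists>y. app A a a = Some y \<and> (y, x) \<in> le A" if x: "x \<in> carrier A" for x
  proof -
    obtain kx y where kx: "app A k x = Some kx" "app A kx a = Some y" "(y, x) \<in> le A"
      using K[OF x ac] by blast
    have "(a, kx) \<in> le A"
      using opas_app_mono[OF A kx(1) m(2) opas_refl[OF A x]] c_app[OF a(1) x] a(2) by auto
    then show ?thesis
      using opas_app_mono[OF A kx(2) _ opas_refl[OF A ac]] kx(3) opas_trans[OF A] by blast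
  qed
  moreover from this obtain z where "app A a a = Some z" using ac by blast
  ultimately show ?thesis using carr[OF ac ac] by auto
qed

section \<open>The OPCA of downsets\<close>

lemma ne_downsetsI:
  assumes "\<alpha> \<noteq> {}" and "\<alpha> \<subseteq> carrier A" and "\<And>a a'. a \<in> \<alpha> \<Longrightarrow> (a', a) \<in> le A \<Longrightarrow> a' \<in> \<alpha>"
  shows "\<alpha> \<in> ne_downsets A"
  using assms by (auto simp: ne_downsets_def)

lemma ne_downsetsD:
  assumes "\<alpha> \<in> ne_downsets A"
  shows "\<alpha> \<noteq> {}" and "a \<in> \<alpha> \<Longrightarrow> a \<in> carrier A" and "a \<in> \<alpha> \<Longrightarrow> (a', a) \<in> le A \<Longrightarrow> a' \<in> \<alpha>"
  using assms by (auto simp: ne_downsets_def)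

lemma down_in_ne_downsets:
  assumes A: "opas A" and "X \<noteq> {}" and "X \<subseteq> carrier A"
  shows "down A X \<in> ne_downsets A"
proof (rule ne_downsetsI)
  show "down A X \<noteq> {}"
    using assms opas_refl[OF A] unfolding down_def by blast
  show "down A X \<subseteq> carrier A"
    using opas_le_carrier(1)[OF A] unfolding down_def by blast
  show "a' \<in> down A X" if "a \<in> down A X" "(a', a) \<in> le A" for a a'
    using that opas_trans[OF A] unfolding down_def by blast
qed

lemma down_subset_iff:
  assumes A: "opas A" and "X \<subseteq> carrier A" and "\<gamma> \<in> ne_downsets A"
  shows "down A X \<subseteq> \<gamma> \<longleftrightarrow> X \<subseteq> \<gamma>"
  using assms(2) opas_refl[OF A] ne_downsetsD(3)[OF assms(3)] unfolding down_def by blast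

lemma T_simps [simp]:
  "carrier (T_opca A) = ne_downsets A"
  "(\<alpha>, \<beta>) \<in> le (T_opca A) \<longleftrightarrow> \<alpha> \<in> ne_downsets A \<and> \<beta> \<in> ne_downsets A \<and> \<alpha> \<subseteq> \<beta>"
  by (auto simp: T_opca_def)

lemma T_app_eq_Some:
  "app (T_opca A) \<alpha> \<beta> = Some \<gamma> \<longleftrightarrow> (\<forall>a\<in>\<alpha>. \<forall>b\<in>\<beta>. pdefined (app A a b)) \<and>
     \<gamma> = down A {c. \<exists>a\<in>\<alpha>. \<exists>b\<in>\<beta>. app A a b = Some c}"
  by (auto simp: T_opca_def)

lemma T_app_closed:
  assumes A: "opas A" and "\<alpha> \<in> ne_downsets A" and "\<beta> \<in> ne_downsets A"
    and "app (T_opca A) \<alpha> \<beta> = Some \<gamma>"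
  shows "\<gamma> \<in> ne_downsets A"
proof -
  have \<gamma>: "\<gamma> = down A {c. \<exists>a\<in>\<alpha>. \<exists>b\<in>\<beta>. app A a b = Some c}"
    and d: "\<forall>a\<in>\<alpha>. \<forall>b\<in>\<beta>. pdefined (app A a b)"
    using assms(4) by (auto simp: T_app_eq_Some)
  obtain a b where "a \<in> \<alpha>" "b \<in> \<beta>"
    using ne_downsetsD(1)[OF assms(2)] ne_downsetsD(1)[OF assms(3)] by blast
  with d have "{c. \<exists>a\<in>\<alpha>. \<exists>b\<in>\<beta>. app A a b = Some c} \<noteq> {}"
    unfolding pdefined_def by blast
  moreover have "{c. \<exists>a\<in>\<alpha>. \<exists>b\<in>\<beta>. app A a b = Some c} \<subseteq> carrier A"
    using opas_app_closed[OF A] ne_downsetsD(2)[OF assms(2)] ne_downsetsD(2)[OF assms(3)] by blast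
  ultimately show ?thesis
    unfolding \<gamma> by (rule down_in_ne_downsets[OF A])
qed

lemma T_app_le_iff:
  assumes A: "opas A" and \<alpha>: "\<alpha> \<in> ne_downsets A" and \<beta>: "\<beta> \<in> ne_downsets A"
    and \<gamma>: "\<gamma> \<in> ne_downsets A"
  shows "(\<exists>\<delta>. app (T_opca A) \<alpha> \<beta> = Some \<delta> \<and> \<delta> \<subseteq> \<gamma>) \<longleftrightarrow> (\<forall>a\<in>\<alpha>. \<forall>b\<in>\<beta>. app_in A a b \<gamma>)"
proof -
  have "{c. \<exists>a\<in>\<alpha>. \<exists>b\<in>\<beta>. app A a b = Some c} \<subseteq> carrier A"
    using opas_app_closed[OF A] ne_downsetsD(2)[OF \<alpha>] ne_downsetsD(2)[OF \<beta>] by blast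
  then show ?thesis
    by (auto simp: T_app_eq_Some down_subset_iff[OF A _ \<gamma>] app_in_def pdefined_def) force+
qed

lemma opas_T:
  assumes A: "opas A"
  shows "opas (T_opca A)"
proof (rule opasI)
  fix \<alpha> \<alpha>' \<beta> \<beta>' \<gamma>
  assume le: "(\<alpha>', \<alpha>) \<in> le (T_opca A)" "(\<beta>', \<beta>) \<in> le (T_opca A)"
    and app: "app (T_opca A) \<alpha> \<beta> = Some \<gamma>"
  then have c: "\<alpha> \<in> ne_downsets A" "\<beta> \<in> ne_downsets A" "\<alpha>' \<in> ne_downsets A" "\<beta>' \<in> ne_downsets A"
    by auto
  have \<gamma>: "\<gamma> \<in> ne_downsets A" using T_app_closed[OF A c(1,2) app] .
  have "\<forall>a\<in>\<alpha>. \<forall>b\<in>\<beta>. app_in A a b \<gamma>"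
    using app T_app_le_iff[OF A c(1,2) \<gamma>] by blast
  then have "\<forall>a\<in>\<alpha>'. \<forall>b\<in>\<beta>'. app_in A a b \<gamma>"
    using le by auto
  then obtain \<delta> where "app (T_opca A) \<alpha>' \<beta>' = Some \<delta>" "\<delta> \<subseteq> \<gamma>"
    using T_app_le_iff[OF A c(3,4) \<gamma>] by blast
  then show "\<exists>\<delta>. app (T_opca A) \<alpha>' \<beta>' = Some \<delta> \<and> (\<delta>, \<gamma>) \<in> le (T_opca A)"
    using \<gamma> T_app_closed[OF A c(3,4)] by auto
qed (auto intro: T_app_closed[OF A])

text \<open>Realizability in \<open>T_opca A\<close> is a condition on elements: a set of realizers works if and only if each
  of its members does. The same holds for two arguments, and it reduces everything about applicative
  morphisms to computations in their codomain.\<close>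

lemma T_ple_iff:
  assumes A: "opas A" and "\<rho> \<in> ne_downsets A" and "\<alpha> \<in> ne_downsets A" and "\<gamma> \<in> ne_downsets A"
  shows "ple (T_opca A) (papp (T_opca A) (Some \<rho>) (Some \<alpha>)) (Some \<gamma>) \<longleftrightarrow>
    (\<forall>r\<in>\<rho>. \<forall>x\<in>\<alpha>. app_in A r x \<gamma>)"
proof -
  have "ple (T_opca A) (papp (T_opca A) (Some \<rho>) (Some \<alpha>)) (Some \<gamma>) \<longleftrightarrow>
     (\<exists>\<delta>. app (T_opca A) \<rho> \<alpha> = Some \<delta> \<and> \<delta> \<subseteq> \<gamma>)"
    using T_app_closed[OF A assms(2,3)] assms(4) by (auto simp: ple_def papp_def)
  then show ?thesis
    using T_app_le_iff[OF assms] by simp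
qed

definition app2_in :: "('a, 'm) opas_scheme \<Rightarrow> 'a \<Rightarrow> 'a \<Rightarrow> 'a \<Rightarrow> 'a set \<Rightarrow> bool" where
  "app2_in A t u v S \<longleftrightarrow> (\<exists>z. app A t u = Some z \<and> app_in A z v S)"

lemma T_ple2_iff:
  assumes A: "opas A" and \<tau>: "\<tau> \<in> ne_downsets A" and \<alpha>: "\<alpha> \<in> ne_downsets A"
    and \<beta>: "\<beta> \<in> ne_downsets A" and \<gamma>: "\<gamma> \<in> ne_downsets A"
  shows "ple (T_opca A) (papp (T_opca A) (papp (T_opca A) (Some \<tau>) (Some \<alpha>)) (Some \<beta>)) (Some \<gamma>) \<longleftrightarrow>
    (\<forall>t\<in>\<tau>. \<forall>x\<in>\<alpha>. \<forall>y\<in>\<beta>. app2_in A t x y \<gamma>)" (is "?L \<longleftrightarrow> ?R")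
proof
  assume ?L
  then obtain \<delta> where \<delta>: "app (T_opca A) \<tau> \<alpha> = Some \<delta>"
    and "ple (T_opca A) (papp (T_opca A) (Some \<delta>) (Some \<beta>)) (Some \<gamma>)"
    by (auto simp: ple_def papp_def bind_eq_Some_conv)
  moreover have \<delta>c: "\<delta> \<in> ne_downsets A" using T_app_closed[OF A \<tau> \<alpha> \<delta>] .
  ultimately have "\<forall>z\<in>\<delta>. \<forall>y\<in>\<beta>. app_in A z y \<gamma>"
    using T_ple_iff[OF A _ \<beta> \<gamma>] by blast
  moreover have "\<forall>t\<in>\<tau>. \<forall>x\<in>\<alpha>. app_in A t x \<delta>"
    using T_app_le_iff[OF A \<tau> \<alpha> \<delta>c] \<delta> by blast
  ultimately show ?R
    unfolding app2_in_def app_in_def by meson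
next
  assume R: ?R
  have "\<forall>t\<in>\<tau>. \<forall>x\<in>\<alpha>. pdefined (app A t x)"
    using R ne_downsetsD(1)[OF \<beta>] unfolding app2_in_def pdefined_def by fastforce
  then obtain \<delta> where \<delta>: "app (T_opca A) \<tau> \<alpha> = Some \<delta>"
    and \<delta>_eq: "\<delta> = down A {c. \<exists>a\<in>\<tau>. \<exists>b\<in>\<alpha>. app A a b = Some c}"
    by (simp add: T_app_eq_Some)
  have \<delta>c: "\<delta> \<in> ne_downsets A" using T_app_closed[OF A \<tau> \<alpha> \<delta>] .
  have "app_in A z y \<gamma>" if "z \<in> \<delta>" and y: "y \<in> \<beta>" for z y
  proof -
    obtain t x c where c: "t \<in> \<tau>" "x \<in> \<alpha>" "app A t x = Some c" "(z, c) \<in> le A"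
      using \<open>z \<in> \<delta>\<close> unfolding \<delta>_eq down_def by blast
    then have "app_in A c y \<gamma>" using R y unfolding app2_in_def by fastforce
    then show ?thesis
      using app_in_mono[OF A _ \<gamma> c(4)] opas_refl[OF A ne_downsetsD(2)[OF \<beta> y]] by blast
  qed
  then have "ple (T_opca A) (papp (T_opca A) (Some \<delta>) (Some \<beta>)) (Some \<gamma>)"
    using T_ple_iff[OF A \<delta>c \<beta> \<gamma>] by blast
  then show ?L using \<delta> by (simp add: papp_def)
qed

lemma app2_in_weaken: "app2_in A t u v S \<Longrightarrow> S \<subseteq> S' \<Longrightarrow> app2_in A t u v S'"
  by (auto simp: app2_in_def app_in_def)

lemma app2_in_mono:
  assumes A: "opas A" and "app2_in A t u v S" and S: "S \<in> ne_downsets A"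
    and "(t', t) \<in> le A" and "(u', u) \<in> le A" and v: "(v', v) \<in> le A"
  shows "app2_in A t' u' v' S"
proof -
  obtain z where z: "app A t u = Some z" "app_in A z v S"
    using assms(2) by (auto simp: app2_in_def)
  then obtain z' where "app A t' u' = Some z'" "(z', z) \<in> le A"
    using opas_app_mono[OF A z(1) assms(4,5)] by blast
  then show ?thesis
    using app_in_mono[OF A z(2) S _ v] unfolding app2_in_def by blast
qed

definition principal :: "('a, 'm) opas_scheme \<Rightarrow> 'a \<Rightarrow> 'a set" where
  "principal A a = {x. (x, a) \<in> le A}"

lemma principal_eq_down: "principal A a = down A {a}"
  by (simp add: principal_def down_def)

lemma principal_in_ne_downsets: "opas A \<Longrightarrow> a \<in> carrier A \<Longrightarrow> principal A a \<in> ne_downsets A"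
  by (simp add: principal_eq_down down_in_ne_downsets)

lemma mem_principal: "opas A \<Longrightarrow> a \<in> carrier A \<Longrightarrow> a \<in> principal A a"
  by (simp add: principal_def opas_refl)

lemma T_app_principal:
  assumes A: "opas A" and a: "a \<in> carrier A" and b: "b \<in> carrier A" and c: "app A a b = Some c"
  shows "app (T_opca A) (principal A a) (principal A b) = Some (principal A c)"
proof -
  have cc: "c \<in> carrier A" using opas_app_closed[OF A a b c] .
  have *: "\<exists>z. app A x y = Some z \<and> (z, c) \<in> le A"
    if "(x, a) \<in> le A" "(y, b) \<in> le A" for x y
    using opas_app_mono[OF A c that] .
  moreover have "(a, a) \<in> le A" "(b, b) \<in> le A"
    using a b opas_refl[OF A] by auto
  moreover from this have "principal A c = down A {d. \<exists>x\<in>principal A a. \<exists>y\<in>principal A b. app A x y = Some d}"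
    (is "_ = down A ?X")
  proof -
    have "c \<in> ?X" using calculation c unfolding principal_def by blast
    moreover have "(d, c) \<in> le A" if "d \<in> ?X" for d
      using that * unfolding principal_def by fastforce
    ultimately show ?thesis
      using opas_trans[OF A] unfolding principal_def down_def by blast
  qed
  ultimately show ?thesis
    using * unfolding T_app_eq_Some principal_def pdefined_def by blast
qed

text \<open>Each variable occurs exactly once in \<open>kab\<close> and in \<open>sabc\<close>, so an element of such a downset comes from
  one choice of elements, to which the axiom in \<open>A\<close> applies. In \<open>ac(bc)\<close> the two occurrences of \<open>c\<close> range
  independently over a downset. This makes its definedness a stronger hypothesis and its value larger.\<close>

lemma combinators_T:
  assumes A: "opas A" and ks: "combinators A k s"
  shows "combinators (T_opca A) (principal A k) (principal A s)"
proof -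
  note carr = opas_app_closed[OF A]
  have K: "\<And>a b. a \<in> carrier A \<Longrightarrow> b \<in> carrier A \<Longrightarrow>
      \<exists>ka y. app A k a = Some ka \<and> app A ka b = Some y \<and> (y, a) \<in> le A"
    and kc: "k \<in> carrier A" "s \<in> carrier A"
    using ks by (auto simp: combinators_def)
  note pk = principal_in_ne_downsets[OF A kc(1)]
  note ps = principal_in_ne_downsets[OF A kc(2)]
  have TK: "\<exists>ka y. app (T_opca A) (principal A k) \<alpha> = Some ka \<and> app (T_opca A) ka \<beta> = Some y \<and>
      (y, \<alpha>) \<in> le (T_opca A)" if \<alpha>: "\<alpha> \<in> ne_downsets A" and \<beta>: "\<beta> \<in> ne_downsets A" for \<alpha> \<beta>
  proof -
    have "app2_in A k' x y \<alpha>" if k': "k' \<in> principal A k" and x: "x \<in> \<alpha>" and y: "y \<in> \<beta>" for k' x y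
    proof -
      have c: "x \<in> carrier A" "y \<in> carrier A"
        using ne_downsetsD(2)[OF \<alpha> x] ne_downsetsD(2)[OF \<beta> y] by auto
      have "app2_in A k x y \<alpha>"
        using K[OF c] ne_downsetsD(3)[OF \<alpha> x] unfolding app2_in_def app_in_def by blast
      then show ?thesis
        using app2_in_mono[OF A _ \<alpha>] k' c opas_refl[OF A] unfolding principal_def by blast
    qed
    then have "ple (T_opca A) (papp (T_opca A) (papp (T_opca A) (Some (principal A k)) (Some \<alpha>)) (Some \<beta>)) (Some \<alpha>)"
      using T_ple2_iff[OF A pk \<alpha> \<beta> \<alpha>] by blast
    then show ?thesis
      by (auto simp: ple_def papp_def bind_eq_Some_conv)
  qed
  have TS: "\<exists>sa sab. app (T_opca A) (principal A s) \<alpha> = Some sa \<and> app (T_opca A) sa \<beta> = Some sab \<and>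
        (\<forall>\<gamma>\<in>ne_downsets A. \<forall>ac bc d. app (T_opca A) \<alpha> \<gamma> = Some ac \<longrightarrow> app (T_opca A) \<beta> \<gamma> = Some bc \<longrightarrow>
           app (T_opca A) ac bc = Some d \<longrightarrow>
           (\<exists>y. app (T_opca A) sab \<gamma> = Some y \<and> (y, d) \<in> le (T_opca A)))"
    if \<alpha>: "\<alpha> \<in> ne_downsets A" and \<beta>: "\<beta> \<in> ne_downsets A" for \<alpha> \<beta>
  proof -
    have "\<exists>sx sxy. app A s' x = Some sx \<and> app A sx y = Some sxy"
      if s': "s' \<in> principal A s" and x: "x \<in> \<alpha>" and y: "y \<in> \<beta>" for s' x y
    proof -
      have c: "x \<in> carrier A" "y \<in> carrier A"
        using ne_downsetsD(2)[OF \<alpha> x] ne_downsetsD(2)[OF \<beta> y] by auto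
      obtain sx sxy where sx: "app A s x = Some sx" "app A sx y = Some sxy"
        by (rule combinators_S[OF ks c]) blast
      obtain sx' where "app A s' x = Some sx'" "(sx', sx) \<in> le A"
        using opas_app_mono[OF A sx(1) _ opas_refl[OF A c(1)]] s' unfolding principal_def by blast
      then show ?thesis
        using opas_app_mono[OF A sx(2) _ opas_refl[OF A c(2)]] by blast
    qed
    note def = this
    obtain sa where sa: "app (T_opca A) (principal A s) \<alpha> = Some sa"
      and sa_eq: "sa = down A {c. \<exists>a\<in>principal A s. \<exists>b\<in>\<alpha>. app A a b = Some c}"
      using def ne_downsetsD(1)[OF \<beta>] by (simp add: T_app_eq_Some pdefined_def) blast
    have sac: "sa \<in> ne_downsets A" using T_app_closed[OF A ps \<alpha> sa] .
    have sa_app: "\<exists>s'\<in>principal A s. \<exists>x\<in>\<alpha>. \<exists>sx. app A s' x = Some sx \<and> (z, sx) \<in> le A"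
      if "z \<in> sa" for z
      using that unfolding sa_eq down_def by blast
    have "pdefined (app A z y)" if "z \<in> sa" "y \<in> \<beta>" for z y
    proof -
      obtain s' x sx where 1: "s' \<in> principal A s" "x \<in> \<alpha>" "app A s' x = Some sx" "(z, sx) \<in> le A"
        using sa_app[OF \<open>z \<in> sa\<close>] by blast
      obtain sxy where "app A sx y = Some sxy" using def[OF 1(1,2) \<open>y \<in> \<beta>\<close>] 1(3) by auto
      then show ?thesis
        using opas_app_mono[OF A _ 1(4) opas_refl[OF A ne_downsetsD(2)[OF \<beta> that(2)]]]
        unfolding pdefined_def by blast
    qed
    then obtain sab where sab: "app (T_opca A) sa \<beta> = Some sab"
      and sab_eq: "sab = down A {c. \<exists>a\<in>sa. \<exists>b\<in>\<beta>. app A a b = Some c}"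
      by (simp add: T_app_eq_Some)
    have sabc: "sab \<in> ne_downsets A" using T_app_closed[OF A sac \<beta> sab] .
    have "\<exists>y. app (T_opca A) sab \<gamma> = Some y \<and> (y, d) \<in> le (T_opca A)"
      if \<gamma>: "\<gamma> \<in> ne_downsets A" and ac: "app (T_opca A) \<alpha> \<gamma> = Some ac"
        and bc: "app (T_opca A) \<beta> \<gamma> = Some bc" and d: "app (T_opca A) ac bc = Some d"
      for \<gamma> ac bc d
    proof -
      have acc: "ac \<in> ne_downsets A" using T_app_closed[OF A \<alpha> \<gamma> ac] .
      have bcc: "bc \<in> ne_downsets A" using T_app_closed[OF A \<beta> \<gamma> bc] .
      have dc: "d \<in> ne_downsets A" using T_app_closed[OF A acc bcc d] .
      have "app_in A w z d" if w: "w \<in> sab" and z: "z \<in> \<gamma>" for w z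
      proof -
        have zc: "z \<in> carrier A" using ne_downsetsD(2)[OF \<gamma> z] .
        obtain v y vy where v: "v \<in> sa" "y \<in> \<beta>" "app A v y = Some vy" "(w, vy) \<in> le A"
          using w unfolding sab_eq down_def by blast
        obtain s' x sx where s': "(s', s) \<in> le A" "x \<in> \<alpha>" "app A s' x = Some sx" "(v, sx) \<in> le A"
          using sa_app[OF v(1)] unfolding principal_def by blast
        have c: "x \<in> carrier A" "y \<in> carrier A"
          using ne_downsetsD(2)[OF \<alpha> s'(2)] ne_downsetsD(2)[OF \<beta> v(2)] by auto
        obtain tx txy where t: "app A s x = Some tx" "app A tx y = Some txy"
          "\<And>c ac bc d. c \<in> carrier A \<Longrightarrow> app A x c = Some ac \<Longrightarrow> app A y c = Some bc \<Longrightarrow>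
            app A ac bc = Some d \<Longrightarrow> \<exists>y. app A txy c = Some y \<and> (y, d) \<in> le A"
          by (rule combinators_S[OF ks c]) blast
        have "(sx, tx) \<in> le A"
          using opas_app_mono[OF A t(1) s'(1) opas_refl[OF A c(1)]] s'(3) by auto
        then have "(v, tx) \<in> le A" using s'(4) opas_trans[OF A] by blast
        then have "(vy, txy) \<in> le A"
          using opas_app_mono[OF A t(2) _ opas_refl[OF A c(2)]] v(3) by fastforce
        then have w_le: "(w, txy) \<in> le A" using v(4) opas_trans[OF A] by blast
        obtain xz yz e where "app A x z = Some xz" "app A y z = Some yz" "app A xz yz = Some e" "e \<in> d"
        proof -
          have "app_in A x z ac" using T_app_le_iff[OF A \<alpha> \<gamma> acc] ac s'(2) z by blast
          moreover have "app_in A y z bc" using T_app_le_iff[OF A \<beta> \<gamma> bcc] bc v(2) z by blast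
          ultimately show ?thesis
            using T_app_le_iff[OF A acc bcc dc] d that unfolding app_in_def by blast
        qed
        then have "app_in A txy z d"
          using t(3)[OF zc] ne_downsetsD(3)[OF dc] unfolding app_in_def by blast
        then show ?thesis
          using app_in_mono[OF A _ dc w_le opas_refl[OF A zc]] by blast
      qed
      then obtain y where "app (T_opca A) sab \<gamma> = Some y" "y \<subseteq> d"
        using T_app_le_iff[OF A sabc \<gamma> dc] by blast
      then show ?thesis
        using T_app_closed[OF A sabc \<gamma>] dc by auto
    qed
    then have "\<forall>\<gamma>\<in>ne_downsets A. \<forall>ac bc d. app (T_opca A) \<alpha> \<gamma> = Some ac \<longrightarrow> app (T_opca A) \<beta> \<gamma> = Some bc \<longrightarrow>
           app (T_opca A) ac bc = Some d \<longrightarrow>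
           (\<exists>y. app (T_opca A) sab \<gamma> = Some y \<and> (y, d) \<in> le (T_opca A))"
      by (intro ballI allI impI)
    then show ?thesis using sa sab by (intro exI conjI)
  qed
  show ?thesis
    unfolding combinators_def T_simps(1)
    using pk ps by (intro conjI ballI TK TS)
qed

section \<open>Applicative morphisms, elementwise\<close>

text \<open>A nonempty downset of realizers contains a realizer, and a realizer generates a principal downset of
  them. This is why realizers for applicative morphisms into \<open>C\<close> can be taken in \<open>C\<close> itself.\<close>

lemma downset_realizer_iff:
  fixes P :: "'a \<Rightarrow> bool"
  assumes C: "opas C" and mono: "\<And>t t'. P t \<Longrightarrow> (t', t) \<in> le C \<Longrightarrow> P t'"
  shows "(\<exists>\<tau>\<in>ne_downsets C. \<forall>t\<in>\<tau>. P t) \<longleftrightarrow> (\<exists>t\<in>carrier C. P t)"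
proof
  assume "\<exists>\<tau>\<in>ne_downsets C. \<forall>t\<in>\<tau>. P t"
  then obtain \<tau> where \<tau>: "\<tau> \<in> ne_downsets C" "\<forall>t\<in>\<tau>. P t" by blast
  obtain t where "t \<in> \<tau>" using ne_downsetsD(1)[OF \<tau>(1)] by blast
  then show "\<exists>t\<in>carrier C. P t" using \<tau>(2) ne_downsetsD(2)[OF \<tau>(1)] by blast
next
  assume "\<exists>t\<in>carrier C. P t"
  then obtain t where t: "t \<in> carrier C" "P t" by blast
  then show "\<exists>\<tau>\<in>ne_downsets C. \<forall>t\<in>\<tau>. P t"
    using mono principal_in_ne_downsets[OF C t(1)]
    by (intro bexI[of _ "principal C t"]) (auto simp: principal_def)
qed

lemma pca_le_iff:
  assumes C: "opas C" and f: "\<And>b. b \<in> carrier B \<Longrightarrow> f b \<in> ne_downsets C"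
    and g: "\<And>b. b \<in> carrier B \<Longrightarrow> g b \<in> ne_downsets C"
  shows "pca_le B C f g \<longleftrightarrow> (\<exists>r\<in>carrier C. \<forall>b\<in>carrier B. \<forall>x\<in>f b. app_in C r x (g b))"
proof -
  have "pca_le B C f g \<longleftrightarrow>
    (\<exists>\<rho>\<in>ne_downsets C. \<forall>b\<in>carrier B. \<forall>r\<in>\<rho>. \<forall>x\<in>f b. app_in C r x (g b))"
    unfolding pca_le_def opca_le_def T_simps(1)
    by (intro bex_cong ball_cong refl T_ple_iff[OF C _ f g])
  also have "\<dots> \<longleftrightarrow> (\<exists>\<rho>\<in>ne_downsets C. \<forall>r\<in>\<rho>. \<forall>b\<in>carrier B. \<forall>x\<in>f b. app_in C r x (g b))"
    by (intro bex_cong refl) blast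
  also have "\<dots> \<longleftrightarrow> (\<exists>r\<in>carrier C. \<forall>b\<in>carrier B. \<forall>x\<in>f b. app_in C r x (g b))"
  proof (rule downset_realizer_iff[OF C], intro ballI)
    fix t t' b x
    assume t: "\<forall>b\<in>carrier B. \<forall>x\<in>f b. app_in C t x (g b)" "(t', t) \<in> le C"
      and x: "b \<in> carrier B" "x \<in> f b"
    then show "app_in C t' x (g b)"
      using app_in_mono[OF C _ g t(2)] opas_refl[OF C] ne_downsetsD(2)[OF f] by blast
  qed
  finally show ?thesis .
qed

lemma pca_arrow_iff:
  assumes B: "opas B" and C: "opas C"
  shows "pca_arrow B C f \<longleftrightarrow> (\<forall>b\<in>carrier B. f b \<in> ne_downsets C) \<and>
    (\<exists>t\<in>carrier C. \<forall>b\<in>carrier B. \<forall>b'\<in>carrier B. \<forall>c. app B b b' = Some c \<longrightarrow>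
       (\<forall>x\<in>f b. \<forall>x'\<in>f b'. app2_in C t x x' (f c))) \<and>
    (\<exists>u\<in>carrier C. \<forall>b b'. (b', b) \<in> le B \<longrightarrow> (\<forall>x\<in>f b'. app_in C u x (f b)))"
    (is "_ \<longleftrightarrow> ?F \<and> ?T \<and> ?U")
proof -
  note carr = opas_app_closed[OF B]
  let ?T' = "\<exists>\<tau>\<in>ne_downsets C. \<forall>b\<in>carrier B. \<forall>b'\<in>carrier B.
        kle (T_opca C) (papp (T_opca C) (papp (T_opca C) (Some \<tau>) (Some (f b))) (Some (f b')))
          (map_option f (app B b b'))"
  let ?U' = "\<exists>\<tau>\<in>ne_downsets C. \<forall>b\<in>carrier B. \<forall>b'\<in>carrier B. (b', b) \<in> le B \<longrightarrow>
        ple (T_opca C) (papp (T_opca C) (Some \<tau>) (Some (f b'))) (Some (f b))"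
  have def: "pca_arrow B C f \<longleftrightarrow> ?F \<and> ?T' \<and> ?U'"
    by (simp add: pca_arrow_def opca_morphism_def)
  have T_iff: "?T' \<longleftrightarrow> ?T" if F: ?F
  proof -
    have fc: "\<And>b. b \<in> carrier B \<Longrightarrow> f b \<in> ne_downsets C" using F by blast
    have "kle (T_opca C) (papp (T_opca C) (papp (T_opca C) (Some \<tau>) (Some (f b))) (Some (f b')))
          (map_option f (app B b b')) \<longleftrightarrow>
        (\<forall>c. app B b b' = Some c \<longrightarrow> (\<forall>t\<in>\<tau>. \<forall>x\<in>f b. \<forall>x'\<in>f b'. app2_in C t x x' (f c)))"
      if \<tau>: "\<tau> \<in> ne_downsets C" and b: "b \<in> carrier B" "b' \<in> carrier B" for \<tau> b b'
    proof (cases "app B b b'")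
      case None
      then show ?thesis by (simp add: kle_def pdefined_def)
    next
      case (Some c)
      have "kle (T_opca C) e (Some (f c)) \<longleftrightarrow> ple (T_opca C) e (Some (f c))" for e
        by (auto simp: kle_def pdefined_def ple_def)
      then show ?thesis
        using T_ple2_iff[OF C \<tau> fc[OF b(1)] fc[OF b(2)] fc[OF carr[OF b Some]]] Some by simp
    qed
    then have "?T' \<longleftrightarrow> (\<exists>\<tau>\<in>ne_downsets C. \<forall>b\<in>carrier B. \<forall>b'\<in>carrier B.
        \<forall>c. app B b b' = Some c \<longrightarrow> (\<forall>t\<in>\<tau>. \<forall>x\<in>f b. \<forall>x'\<in>f b'. app2_in C t x x' (f c)))"
      by (simp cong: bex_cong)
    also have "\<dots> \<longleftrightarrow> (\<exists>\<tau>\<in>ne_downsets C. \<forall>t\<in>\<tau>. \<forall>b\<in>carrier B. \<forall>b'\<in>carrier B.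
        \<forall>c. app B b b' = Some c \<longrightarrow> (\<forall>x\<in>f b. \<forall>x'\<in>f b'. app2_in C t x x' (f c)))"
      by (intro bex_cong refl) blast
    also have "\<dots> \<longleftrightarrow> ?T"
    proof (rule downset_realizer_iff[OF C], intro ballI allI impI)
      fix t t' b b' c x x'
      assume t: "\<forall>b\<in>carrier B. \<forall>b'\<in>carrier B. \<forall>c. app B b b' = Some c \<longrightarrow>
          (\<forall>x\<in>f b. \<forall>x'\<in>f b'. app2_in C t x x' (f c))" and le: "(t', t) \<in> le C"
        and b: "b \<in> carrier B" "b' \<in> carrier B" "app B b b' = Some c" "x \<in> f b" "x' \<in> f b'"
      have "app2_in C t x x' (f c)" using t b by blast
      then show "app2_in C t' x x' (f c)"
        by (rule app2_in_mono[OF C _ fc[OF carr[OF b(1-3)]] le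
              opas_refl[OF C ne_downsetsD(2)[OF fc[OF b(1)] b(4)]]
              opas_refl[OF C ne_downsetsD(2)[OF fc[OF b(2)] b(5)]]])
    qed
    finally show ?thesis .
  qed
  have U_iff: "?U' \<longleftrightarrow> ?U" if F: ?F
  proof -
    have fc: "\<And>b. b \<in> carrier B \<Longrightarrow> f b \<in> ne_downsets C" using F by blast
    have "?U' \<longleftrightarrow> (\<exists>\<tau>\<in>ne_downsets C. \<forall>b\<in>carrier B. \<forall>b'\<in>carrier B. (b', b) \<in> le B \<longrightarrow>
        (\<forall>t\<in>\<tau>. \<forall>x\<in>f b'. app_in C t x (f b)))"
      by (intro bex_cong ball_cong imp_cong refl T_ple_iff[OF C _ fc fc])
    also have "\<dots> \<longleftrightarrow> (\<exists>\<tau>\<in>ne_downsets C. \<forall>t\<in>\<tau>. \<forall>b b'. (b', b) \<in> le B \<longrightarrow>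
        (\<forall>x\<in>f b'. app_in C t x (f b)))"
      using opas_le_carrier[OF B] by (intro bex_cong refl) blast
    also have "\<dots> \<longleftrightarrow> ?U"
    proof (rule downset_realizer_iff[OF C], intro ballI allI impI)
      fix t t' b b' x
      assume t: "\<forall>b b'. (b', b) \<in> le B \<longrightarrow> (\<forall>x\<in>f b'. app_in C t x (f b))"
        and le: "(t', t) \<in> le C" and b: "(b', b) \<in> le B" "x \<in> f b'"
      have "app_in C t x (f b)" using t b by blast
      then show "app_in C t' x (f b)"
        by (rule app_in_mono[OF C _ fc[OF opas_le_carrier(2)[OF B b(1)]] le
              opas_refl[OF C ne_downsetsD(2)[OF fc[OF opas_le_carrier(1)[OF B b(1)]] b(2)]]])
    qed
    finally show ?thesis .
  qed
  show ?thesis unfolding def by (intro conj_cong refl T_iff U_iff)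
qed

text \<open>The downward closure in the definition adds nothing to the union, as it only adds smaller downsets.\<close>

lemma pca_comp_eq_Union:
  assumes "\<And>b. b \<in> f a \<Longrightarrow> g b \<in> ne_downsets C"
  shows "pca_comp C g f a = (\<Union>b\<in>f a. g b)"
proof -
  have "(g b, g b) \<in> le (T_opca C)" if "b \<in> f a" for b
    using assms[OF that] by simp
  then have "(\<Union>b\<in>f a. g b) \<subseteq> pca_comp C g f a"
    unfolding pca_comp_def down_def by blast
  moreover have "pca_comp C g f a \<subseteq> (\<Union>b\<in>f a. g b)"
    unfolding pca_comp_def down_def T_simps by blast
  ultimately show ?thesis by blast
qed

lemma Union_in_ne_downsets:
  assumes "I \<noteq> {}" and "\<And>b. b \<in> I \<Longrightarrow> g b \<in> ne_downsets C"
  shows "(\<Union>b\<in>I. g b) \<in> ne_downsets C"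
proof (rule ne_downsetsI)
  obtain b where "b \<in> I" using assms(1) by blast
  then show "(\<Union>b\<in>I. g b) \<noteq> {}" using ne_downsetsD(1)[OF assms(2)] by blast
  show "(\<Union>b\<in>I. g b) \<subseteq> carrier C" using ne_downsetsD(2)[OF assms(2)] by blast
  show "a' \<in> (\<Union>b\<in>I. g b)" if "a \<in> (\<Union>b\<in>I. g b)" "(a', a) \<in> le C" for a a'
    using that ne_downsetsD(3)[OF assms(2)] by blast
qed

section \<open>Products, and OPCAs with renamed elements\<close>

definition prod_opas :: "'a opas \<Rightarrow> 'b opas \<Rightarrow> ('a \<times> 'b) opas" where
  "prod_opas A B =
     \<lparr>carrier = carrier A \<times> carrier B,
      le = {(x, y). (fst x, fst y) \<in> le A \<and> (snd x, snd y) \<in> le B},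
      app = (\<lambda>x y. Option.bind (app A (fst x) (fst y))
        (\<lambda>a. Option.bind (app B (snd x) (snd y)) (\<lambda>b. Some (a, b))))\<rparr>"

lemma prod_opas_simps [simp]:
  "carrier (prod_opas A B) = carrier A \<times> carrier B"
  "(x, y) \<in> le (prod_opas A B) \<longleftrightarrow> (fst x, fst y) \<in> le A \<and> (snd x, snd y) \<in> le B"
  "app (prod_opas A B) x y = Some z \<longleftrightarrow>
     app A (fst x) (fst y) = Some (fst z) \<and> app B (snd x) (snd y) = Some (snd z)"
  by (auto simp: prod_opas_def bind_eq_Some_conv prod_eq_iff)

lemma opas_prod:
  assumes A: "opas A" and B: "opas B"
  shows "opas (prod_opas A B)"
proof (rule opasI)
  show "le (prod_opas A B) \<subseteq> carrier (prod_opas A B) \<times> carrier (prod_opas A B)"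
    using opas_le_carrier[OF A] opas_le_carrier[OF B] by auto
next
  fix x x' y y' z
  assume "(x', x) \<in> le (prod_opas A B)" "(y', y) \<in> le (prod_opas A B)"
    "app (prod_opas A B) x y = Some z"
  then show "\<exists>z'. app (prod_opas A B) x' y' = Some z' \<and> (z', z) \<in> le (prod_opas A B)"
    using opas_app_mono[OF A, of "fst x" "fst y" "fst z" "fst x'" "fst y'"]
      opas_app_mono[OF B, of "snd x" "snd y" "snd z" "snd x'" "snd y'"] by auto
next
  fix x y z
  assume "(x, y) \<in> le (prod_opas A B)" "(y, z) \<in> le (prod_opas A B)"
  then show "(x, z) \<in> le (prod_opas A B)"
    using opas_trans[OF A, of "fst x" "fst y" "fst z"] opas_trans[OF B, of "snd x" "snd y" "snd z"]
    by simp
next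
  fix x y
  assume "(x, y) \<in> le (prod_opas A B)" "(y, x) \<in> le (prod_opas A B)"
  then show "x = y"
    using opas_antisym[OF A, of "fst x" "fst y"] opas_antisym[OF B, of "snd x" "snd y"]
    by (simp add: prod_eq_iff)
next
  fix x y z
  assume "x \<in> carrier (prod_opas A B)" "y \<in> carrier (prod_opas A B)"
    "app (prod_opas A B) x y = Some z"
  then show "z \<in> carrier (prod_opas A B)"
    using opas_app_closed[OF A, of "fst x" "fst y" "fst z"]
      opas_app_closed[OF B, of "snd x" "snd y" "snd z"]
    by (simp add: mem_Times_iff)
qed (auto intro: opas_refl[OF A] opas_refl[OF B])

lemma combinators_prod:
  assumes A: "combinators A k s" and B: "combinators B k' s'"
  shows "combinators (prod_opas A B) (k, k') (s, s')"
  unfolding combinators_def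
proof (intro conjI ballI)
  show "(k, k') \<in> carrier (prod_opas A B)" "(s, s') \<in> carrier (prod_opas A B)"
    using A B by (auto simp: combinators_def)
next
  fix x y assume "x \<in> carrier (prod_opas A B)" "y \<in> carrier (prod_opas A B)"
  then have c: "fst x \<in> carrier A" "fst y \<in> carrier A" "snd x \<in> carrier B" "snd y \<in> carrier B"
    by auto
  obtain ka u where 1: "app A k (fst x) = Some ka" "app A ka (fst y) = Some u" "(u, fst x) \<in> le A"
    using A c(1,2) unfolding combinators_def by blast
  obtain kb v where 2: "app B k' (snd x) = Some kb" "app B kb (snd y) = Some v" "(v, snd x) \<in> le B"
    using B c(3,4) unfolding combinators_def by blast
  show "\<exists>ka z. app (prod_opas A B) (k, k') x = Some ka \<and> app (prod_opas A B) ka y = Some z \<and>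
      (z, x) \<in> le (prod_opas A B)"
    by (rule exI[of _ "(ka, kb)"], rule exI[of _ "(u, v)"]) (simp add: 1 2)
next
  fix x y assume "x \<in> carrier (prod_opas A B)" "y \<in> carrier (prod_opas A B)"
  then have c: "fst x \<in> carrier A" "fst y \<in> carrier A" "snd x \<in> carrier B" "snd y \<in> carrier B"
    by auto
  obtain sa sab where 1: "app A s (fst x) = Some sa" "app A sa (fst y) = Some sab"
    "\<And>c ac bc d. c \<in> carrier A \<Longrightarrow> app A (fst x) c = Some ac \<Longrightarrow> app A (fst y) c = Some bc \<Longrightarrow>
      app A ac bc = Some d \<Longrightarrow> \<exists>y. app A sab c = Some y \<and> (y, d) \<in> le A"
    by (rule combinators_S[OF A c(1,2)]) blast
  obtain ta tab where 2: "app B s' (snd x) = Some ta" "app B ta (snd y) = Some tab"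
    "\<And>c ac bc d. c \<in> carrier B \<Longrightarrow> app B (snd x) c = Some ac \<Longrightarrow> app B (snd y) c = Some bc \<Longrightarrow>
      app B ac bc = Some d \<Longrightarrow> \<exists>y. app B tab c = Some y \<and> (y, d) \<in> le B"
    by (rule combinators_S[OF B c(3,4)]) blast
  have "\<exists>w. app (prod_opas A B) (sab, tab) z = Some w \<and> (w, d) \<in> le (prod_opas A B)"
    if z: "z \<in> carrier (prod_opas A B)" "app (prod_opas A B) x z = Some xz"
      "app (prod_opas A B) y z = Some yz" "app (prod_opas A B) xz yz = Some d" for z xz yz d
  proof -
    obtain u where "app A sab (fst z) = Some u" "(u, fst d) \<in> le A"
      using 1(3)[of "fst z" "fst xz" "fst yz" "fst d"] z by auto
    moreover obtain v where "app B tab (snd z) = Some v" "(v, snd d) \<in> le B"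
      using 2(3)[of "snd z" "snd xz" "snd yz" "snd d"] z by auto
    ultimately show ?thesis by (intro exI[of _ "(u, v)"]) simp
  qed
  then have "\<forall>z\<in>carrier (prod_opas A B). \<forall>xz yz d. app (prod_opas A B) x z = Some xz \<longrightarrow>
      app (prod_opas A B) y z = Some yz \<longrightarrow> app (prod_opas A B) xz yz = Some d \<longrightarrow>
      (\<exists>w. app (prod_opas A B) (sab, tab) z = Some w \<and> (w, d) \<in> le (prod_opas A B))"
    by (intro ballI allI impI)
  moreover have "app (prod_opas A B) (s, s') x = Some (sa, ta)"
    "app (prod_opas A B) (sa, ta) y = Some (sab, tab)"
    using 1 2 by auto
  ultimately show "\<exists>u v. app (prod_opas A B) (s, s') x = Some u \<and> app (prod_opas A B) u y = Some v \<and>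
      (\<forall>z\<in>carrier (prod_opas A B). \<forall>xz yz d. app (prod_opas A B) x z = Some xz \<longrightarrow>
      app (prod_opas A B) y z = Some yz \<longrightarrow> app (prod_opas A B) xz yz = Some d \<longrightarrow>
      (\<exists>w. app (prod_opas A B) v z = Some w \<and> (w, d) \<in> le (prod_opas A B)))"
    by (intro exI conjI)
qed

text \<open>The substructure of \<open>D\<close> on \<open>X\<close>, transported along an injection \<open>\<iota>\<close>. It realizes an OPCA of small
  cardinality inside the given universe.\<close>

definition relabel :: "('d \<Rightarrow> 'u) \<Rightarrow> 'd set \<Rightarrow> 'd opas \<Rightarrow> 'u opas" where
  "relabel \<iota> X D =
     \<lparr>carrier = \<iota> ` X,
      le = {(\<iota> x, \<iota> y) |x y. x \<in> X \<and> y \<in> X \<and> (x, y) \<in> le D},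
      app = (\<lambda>b b'. map_option \<iota> (app D (inv_into X \<iota> b) (inv_into X \<iota> b')))\<rparr>"

lemma relabel_simps:
  assumes "inj_on \<iota> X"
  shows "carrier (relabel \<iota> X D) = \<iota> ` X"
    and "x \<in> X \<Longrightarrow> y \<in> X \<Longrightarrow> (\<iota> x, \<iota> y) \<in> le (relabel \<iota> X D) \<longleftrightarrow> (x, y) \<in> le D"
    and "x \<in> X \<Longrightarrow> y \<in> X \<Longrightarrow> app (relabel \<iota> X D) (\<iota> x) (\<iota> y) = map_option \<iota> (app D x y)"
    and "le (relabel \<iota> X D) \<subseteq> \<iota> ` X \<times> \<iota> ` X"
  using assms by (auto simp: relabel_def inj_on_eq_iff[OF assms])

lemma opas_relabel:
  assumes D: "opas D" and inj: "inj_on \<iota> X" and X: "X \<subseteq> carrier D"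
    and closed: "\<And>x y z. x \<in> X \<Longrightarrow> y \<in> X \<Longrightarrow> app D x y = Some z \<Longrightarrow> z \<in> X"
  shows "opas (relabel \<iota> X D)"
proof (rule opasI)
  note [simp] = relabel_simps(1-3)[OF inj]
  note le = relabel_simps(4)[OF inj, of D]
  show "le (relabel \<iota> X D) \<subseteq> carrier (relabel \<iota> X D) \<times> carrier (relabel \<iota> X D)"
    using le by simp
  show "(a, a) \<in> le (relabel \<iota> X D)" if "a \<in> carrier (relabel \<iota> X D)" for a
    using that X opas_refl[OF D] by auto
  show "(a, c) \<in> le (relabel \<iota> X D)"
    if ab: "(a, b) \<in> le (relabel \<iota> X D)" and bc: "(b, c) \<in> le (relabel \<iota> X D)" for a b c
  proof -
    obtain x y z where "a = \<iota> x" "b = \<iota> y" "c = \<iota> z" "x \<in> X" "y \<in> X" "z \<in> X"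
      using ab bc le by blast
    then show ?thesis using ab bc opas_trans[OF D, of x y z] by simp
  qed
  show "a = b"
    if ab: "(a, b) \<in> le (relabel \<iota> X D)" and ba: "(b, a) \<in> le (relabel \<iota> X D)" for a b
  proof -
    obtain x y where "a = \<iota> x" "b = \<iota> y" "x \<in> X" "y \<in> X"
      using ab le by blast
    then show ?thesis using ab ba opas_antisym[OF D, of x y] by simp
  qed
  show "c \<in> carrier (relabel \<iota> X D)"
    if "a \<in> carrier (relabel \<iota> X D)" "b \<in> carrier (relabel \<iota> X D)" "app (relabel \<iota> X D) a b = Some c"
    for a b c
  proof -
    obtain x y where eq: "a = \<iota> x" "b = \<iota> y" and mem: "x \<in> X" "y \<in> X"
      using \<open>a \<in> carrier (relabel \<iota> X D)\<close> \<open>b \<in> carrier (relabel \<iota> X D)\<close> by auto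
    then obtain z where "app D x y = Some z" "c = \<iota> z"
      using \<open>app (relabel \<iota> X D) a b = Some c\<close> by auto
    then show ?thesis using closed[OF mem] by simp
  qed
  show "\<exists>c'. app (relabel \<iota> X D) a' b' = Some c' \<and> (c', c) \<in> le (relabel \<iota> X D)"
    if a: "(a', a) \<in> le (relabel \<iota> X D)" and b: "(b', b) \<in> le (relabel \<iota> X D)"
      and c: "app (relabel \<iota> X D) a b = Some c" for a a' b b' c
  proof -
    obtain x x' y y' where eq: "a = \<iota> x" "a' = \<iota> x'" "b = \<iota> y" "b' = \<iota> y'"
      and mem: "x \<in> X" "x' \<in> X" "y \<in> X" "y' \<in> X"
      using a b le by blast
    obtain z where z: "app D x y = Some z" "c = \<iota> z" using c eq mem by auto
    obtain z' where z': "app D x' y' = Some z'" "(z', z) \<in> le D"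
      using opas_app_mono[OF D z(1)] a b eq mem by auto
    then show ?thesis
      using eq mem z closed[OF mem(2,4) z'(1)] closed[OF mem(1,3) z(1)] by simp
  qed
qed

lemma combinators_relabel:
  assumes ks: "combinators D k s" and inj: "inj_on \<iota> X" and X: "X \<subseteq> carrier D"
    and closed: "\<And>x y z. x \<in> X \<Longrightarrow> y \<in> X \<Longrightarrow> app D x y = Some z \<Longrightarrow> z \<in> X"
    and k: "k \<in> X" and s: "s \<in> X"
  shows "combinators (relabel \<iota> X D) (\<iota> k) (\<iota> s)"
  unfolding combinators_def relabel_simps(1)[OF inj]
proof (intro conjI ballI)
  note [simp] = relabel_simps(1-3)[OF inj]
  show "\<iota> k \<in> \<iota> ` X" "\<iota> s \<in> \<iota> ` X" using k s by auto
  fix a b assume "a \<in> \<iota> ` X" "b \<in> \<iota> ` X"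
  then obtain x y where x: "a = \<iota> x" "x \<in> X" and y: "b = \<iota> y" "y \<in> X" by blast
  have c: "x \<in> carrier D" "y \<in> carrier D" using x y X by auto
  obtain kx z where kx: "app D k x = Some kx" "app D kx y = Some z" "(z, x) \<in> le D"
    using ks c unfolding combinators_def by blast
  have "kx \<in> X" "z \<in> X" using closed kx k x y by blast+
  then show "\<exists>ka z. app (relabel \<iota> X D) (\<iota> k) a = Some ka \<and> app (relabel \<iota> X D) ka b = Some z \<and>
      (z, a) \<in> le (relabel \<iota> X D)"
    using kx k x y by simp
  obtain sx sxy where sx: "app D s x = Some sx" "app D sx y = Some sxy"
    "\<And>c ac bc d. c \<in> carrier D \<Longrightarrow> app D x c = Some ac \<Longrightarrow> app D y c = Some bc \<Longrightarrow>
      app D ac bc = Some d \<Longrightarrow> \<exists>y. app D sxy c = Some y \<and> (y, d) \<in> le D"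
    by (rule combinators_S[OF ks c]) blast
  have sxX: "sx \<in> X" "sxy \<in> X" using closed sx(1,2) s x y by blast+
  have "\<exists>w. app (relabel \<iota> X D) (\<iota> sxy) c = Some w \<and> (w, d) \<in> le (relabel \<iota> X D)"
    if "c \<in> \<iota> ` X" "app (relabel \<iota> X D) a c = Some ac" "app (relabel \<iota> X D) b c = Some bc"
      "app (relabel \<iota> X D) ac bc = Some d" for c ac bc d
  proof -
    obtain z where z: "c = \<iota> z" "z \<in> X" using \<open>c \<in> \<iota> ` X\<close> by blast
    obtain xz where xz: "app D x z = Some xz" "ac = \<iota> xz"
      using \<open>app (relabel \<iota> X D) a c = Some ac\<close> x z by auto
    obtain yz where yz: "app D y z = Some yz" "bc = \<iota> yz"
      using \<open>app (relabel \<iota> X D) b c = Some bc\<close> y z by auto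
    have mem: "xz \<in> X" "yz \<in> X" using closed xz yz x y z by blast+
    obtain e where e: "app D xz yz = Some e" "d = \<iota> e"
      using \<open>app (relabel \<iota> X D) ac bc = Some d\<close> mem xz yz by auto
    have "e \<in> X" using closed[OF mem e(1)] .
    moreover obtain w where w: "app D sxy z = Some w" "(w, e) \<in> le D"
      using sx(3)[OF _ xz(1) yz(1) e(1)] z X by blast
    moreover have "w \<in> X" using closed[OF sxX(2) z(2) w(1)] .
    ultimately show ?thesis using z sxX e by simp
  qed
  then have "\<forall>c\<in>\<iota> ` X. \<forall>ac bc d. app (relabel \<iota> X D) a c = Some ac \<longrightarrow> app (relabel \<iota> X D) b c = Some bc \<longrightarrow>
      app (relabel \<iota> X D) ac bc = Some d \<longrightarrow>
      (\<exists>w. app (relabel \<iota> X D) (\<iota> sxy) c = Some w \<and> (w, d) \<in> le (relabel \<iota> X D))"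
    by (intro ballI allI impI)
  moreover have "app (relabel \<iota> X D) (\<iota> s) a = Some (\<iota> sx)" "app (relabel \<iota> X D) (\<iota> sx) b = Some (\<iota> sxy)"
    using sx(1,2) sxX s x y by simp_all
  ultimately show "\<exists>sa sab. app (relabel \<iota> X D) (\<iota> s) a = Some sa \<and> app (relabel \<iota> X D) sa b = Some sab \<and>
      (\<forall>c\<in>\<iota> ` X. \<forall>ac bc d. app (relabel \<iota> X D) a c = Some ac \<longrightarrow> app (relabel \<iota> X D) b c = Some bc \<longrightarrow>
      app (relabel \<iota> X D) ac bc = Some d \<longrightarrow>
      (\<exists>w. app (relabel \<iota> X D) sab c = Some w \<and> (w, d) \<in> le (relabel \<iota> X D)))"
    by (intro exI conjI)
qed

lemma pca_le_relabel_iff: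
  assumes C: "opas C" and inj: "inj_on \<iota> X"
    and f: "\<And>x. x \<in> X \<Longrightarrow> f (\<iota> x) \<in> ne_downsets C"
    and g: "\<And>x. x \<in> X \<Longrightarrow> g (\<iota> x) \<in> ne_downsets C"
  shows "pca_le (relabel \<iota> X D) C f g \<longleftrightarrow>
    (\<exists>r\<in>carrier C. \<forall>x\<in>X. \<forall>v\<in>f (\<iota> x). app_in C r v (g (\<iota> x)))"
  using f g
  by (subst pca_le_iff[OF C]) (auto simp: relabel_simps(1)[OF inj])

lemma pca_arrow_relabel_iff:
  assumes B: "opas (relabel \<iota> X D)" and C: "opas C" and inj: "inj_on \<iota> X"
  shows "pca_arrow (relabel \<iota> X D) C f \<longleftrightarrow> (\<forall>x\<in>X. f (\<iota> x) \<in> ne_downsets C) \<and>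
    (\<exists>t\<in>carrier C. \<forall>x\<in>X. \<forall>y\<in>X. \<forall>z. app D x y = Some z \<longrightarrow>
       (\<forall>v\<in>f (\<iota> x). \<forall>w\<in>f (\<iota> y). app2_in C t v w (f (\<iota> z)))) \<and>
    (\<exists>u\<in>carrier C. \<forall>x\<in>X. \<forall>y\<in>X. (y, x) \<in> le D \<longrightarrow> (\<forall>v\<in>f (\<iota> y). app_in C u v (f (\<iota> x))))"
proof -
  have U: "(\<forall>b b'. (b', b) \<in> le (relabel \<iota> X D) \<longrightarrow> P b' b) \<longleftrightarrow>
      (\<forall>x\<in>X. \<forall>y\<in>X. (y, x) \<in> le D \<longrightarrow> P (\<iota> y) (\<iota> x))" for P
    unfolding relabel_def by auto
  have "(\<forall>z. map_option \<iota> (app D x y) = Some z \<longrightarrow> P z) \<longleftrightarrow> (\<forall>z. app D x y = Some z \<longrightarrow> P (\<iota> z))"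
    for x y P by auto
  then show ?thesis
    unfolding pca_arrow_iff[OF B C] relabel_simps(1)[OF inj] U
    by (simp add: relabel_simps(3)[OF inj])
qed

section \<open>Counting terms\<close>

text \<open>Names for the downsets of the test object, used only to bound their number. Each constructor
  corresponds to one of the closure conditions of \<open>test_downsets\<close>.\<close>

datatype 'u test_term = Gen "'u \<times> 'u" | Hull "'u test_term" | Avoid "'u test_term"
  | App "'u test_term" "'u test_term"

primrec encode :: "(nat \<Rightarrow> 'u) \<Rightarrow> ('u \<times> 'u \<Rightarrow> 'u) \<Rightarrow> 'u test_term \<Rightarrow> 'u" where
  "encode tag p (Gen a) = p (tag 0, p a)"
| "encode tag p (Hull t) = p (tag 1, encode tag p t)"
| "encode tag p (Avoid t) = p (tag 2, encode tag p t)"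
| "encode tag p (App t t') = p (tag 3, p (encode tag p t, encode tag p t'))"

lemma inj_encode:
  assumes tag: "inj tag" and p: "inj p"
  shows "encode tag p t = encode tag p t' \<Longrightarrow> t = t'"
proof (induction t arbitrary: t')
  case (Gen a)
  then show ?case by (cases t') (auto simp: inj_eq[OF tag] inj_eq[OF p])
next
  case (Hull t)
  from Hull.prems show ?case
    by (cases t') (auto simp: inj_eq[OF tag] inj_eq[OF p] dest: Hull.IH)
next
  case (Avoid t)
  from Avoid.prems show ?case
    by (cases t') (auto simp: inj_eq[OF tag] inj_eq[OF p] dest: Avoid.IH)
next
  case (App t1 t2)
  from App.prems show ?case
    by (cases t') (auto simp: inj_eq[OF tag] inj_eq[OF p] dest: App.IH)
qed

text \<open>By the axiom of choice, an infinite type admits an injective pairing, and pairs with four distinct tags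
  suffice to encode terms.\<close>

lemma ex_inj_test_term:
  assumes "infinite (UNIV :: 'u set)"
  shows "\<exists>c :: 'u test_term \<Rightarrow> 'u. inj c"
proof -
  obtain tag :: "nat \<Rightarrow> 'u" where "inj tag"
    using infinite_countable_subset[OF assms] by auto
  moreover obtain p :: "'u \<times> 'u \<Rightarrow> 'u" where "inj p"
    using card_of_ordIso[THEN iffD2, OF card_of_Times_same_infinite[OF assms]]
    unfolding UNIV_Times_UNIV bij_betw_def by blast
  ultimately have "inj (encode tag p)"
    using inj_encode by (intro injI)
  then show ?thesis by blast
qed

section \<open>The test object\<close>

text \<open>The smallest rectangle that contains \<open>\<alpha>\<close>; it has the same projections as \<open>\<alpha>\<close>.\<close>

definition hull :: "('a \<times> 'b) set \<Rightarrow> ('a \<times> 'b) set" where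
  "hull \<alpha> = fst ` \<alpha> \<times> snd ` \<alpha>"

definition avoiding :: "('a, 'm) opas_scheme \<Rightarrow> 'a set \<Rightarrow> 'a set" where
  "avoiding A \<alpha> = {a \<in> carrier A. \<exists>x\<in>\<alpha>. (x, a) \<notin> le A}"

text \<open>The principal downsets are there to contain the combinators and to define \<open>g2\<close>; closure under \<open>hull\<close>
  is there to define \<open>g1\<close>; the downsets \<open>avoiding A \<alpha>\<close> separate the two.\<close>

inductive_set test_downsets :: "('a \<times> 'b) opas \<Rightarrow> ('a \<times> 'b) set set" for A where
  principal: "a \<in> carrier A \<Longrightarrow> principal A a \<in> test_downsets A"
| hull: "\<alpha> \<in> test_downsets A \<Longrightarrow> hull \<alpha> \<in> test_downsets A"
| avoiding: "\<alpha> \<in> test_downsets A \<Longrightarrow> avoiding A \<alpha> \<in> test_downsets A"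
| app: "\<alpha> \<in> test_downsets A \<Longrightarrow> \<beta> \<in> test_downsets A \<Longrightarrow> app (T_opca A) \<alpha> \<beta> = Some \<gamma> \<Longrightarrow>
    \<gamma> \<in> test_downsets A"

primrec eval_test :: "('u \<times> 'u) opas \<Rightarrow> 'u test_term \<Rightarrow> ('u \<times> 'u) set" where
  "eval_test A (Gen a) = principal A a"
| "eval_test A (Hull t) = hull (eval_test A t)"
| "eval_test A (Avoid t) = avoiding A (eval_test A t)"
| "eval_test A (App t t') = the (app (T_opca A) (eval_test A t) (eval_test A t'))"

lemma test_downsets_subset_range:
  "\<alpha> \<in> test_downsets A \<Longrightarrow> \<alpha> \<in> range (eval_test A)"
proof (induction rule: test_downsets.induct)
  case (principal a)
  show ?case by (rule range_eqI[of _ _ "Gen a"]) simp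
next
  case (hull \<alpha>)
  then obtain t where "\<alpha> = eval_test A t" by blast
  then show ?case by (intro range_eqI[of _ _ "Hull t"]) simp
next
  case (avoiding \<alpha>)
  then obtain t where "\<alpha> = eval_test A t" by blast
  then show ?case by (intro range_eqI[of _ _ "Avoid t"]) simp
next
  case (app \<alpha> \<beta> \<gamma>)
  then obtain t t' where "\<alpha> = eval_test A t" "\<beta> = eval_test A t'" by blast
  then show ?case using app.hyps by (intro range_eqI[of _ _ "App t t'"]) simp
qed

lemma ex_inj_on_test_downsets:
  fixes A :: "('u \<times> 'u) opas"
  assumes "infinite (UNIV :: 'u set)"
  shows "\<exists>\<iota> :: ('u \<times> 'u) set \<Rightarrow> 'u. inj_on \<iota> (test_downsets A)"
proof -
  obtain c :: "'u test_term \<Rightarrow> 'u" where c: "inj c"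
    using ex_inj_test_term[OF assms] by blast
  have "inj_on (inv_into UNIV (eval_test A)) (test_downsets A)"
    using test_downsets_subset_range by (intro inj_on_inv_into) blast
  then have "inj_on (c \<circ> inv_into UNIV (eval_test A)) (test_downsets A)"
    using c by (intro comp_inj_on) (auto intro: inj_on_subset)
  then show ?thesis by blast
qed

lemma avoiding_in_ne_downsets:
  assumes A: "opas A" and least: "\<And>z. z \<in> carrier A \<Longrightarrow> \<exists>a\<in>carrier A. (z, a) \<notin> le A"
    and \<alpha>: "\<alpha> \<in> ne_downsets A"
  shows "avoiding A \<alpha> \<in> ne_downsets A"
proof (rule ne_downsetsI)
  obtain x where "x \<in> \<alpha>" using ne_downsetsD(1)[OF \<alpha>] by blast
  then show "avoiding A \<alpha> \<noteq> {}"
    using least[OF ne_downsetsD(2)[OF \<alpha>]] unfolding avoiding_def by blast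
  show "avoiding A \<alpha> \<subseteq> carrier A" by (auto simp: avoiding_def)
  show "a' \<in> avoiding A \<alpha>" if "a \<in> avoiding A \<alpha>" "(a', a) \<in> le A" for a a'
    using that opas_trans[OF A] opas_le_carrier(1)[OF A] unfolding avoiding_def by blast
qed

lemma fst_hull: "fst ` hull \<alpha> = fst ` \<alpha>" and snd_hull: "snd ` hull \<alpha> = snd ` \<alpha>"
  by (force simp: hull_def)+

lemma image_fst_in_ne_downsets:
  assumes A: "opas A" and B: "opas B" and \<alpha>: "\<alpha> \<in> ne_downsets (prod_opas A B)"
  shows "fst ` \<alpha> \<in> ne_downsets A"
proof (rule ne_downsetsI)
  show "fst ` \<alpha> \<noteq> {}" using ne_downsetsD(1)[OF \<alpha>] by simp
  show "fst ` \<alpha> \<subseteq> carrier A" using ne_downsetsD(2)[OF \<alpha>] by fastforce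
  fix a a' assume "a \<in> fst ` \<alpha>" and le: "(a', a) \<in> le A"
  then obtain b where b: "(a, b) \<in> \<alpha>" by force
  then have "b \<in> carrier B" using ne_downsetsD(2)[OF \<alpha> b] by simp
  then have "(a', b) \<in> \<alpha>" using ne_downsetsD(3)[OF \<alpha> b, of "(a', b)"] le opas_refl[OF B] by simp
  then show "a' \<in> fst ` \<alpha>" by force
qed

lemma image_snd_in_ne_downsets:
  assumes A: "opas A" and B: "opas B" and \<alpha>: "\<alpha> \<in> ne_downsets (prod_opas A B)"
  shows "snd ` \<alpha> \<in> ne_downsets B"
proof (rule ne_downsetsI)
  show "snd ` \<alpha> \<noteq> {}" using ne_downsetsD(1)[OF \<alpha>] by simp
  show "snd ` \<alpha> \<subseteq> carrier B" using ne_downsetsD(2)[OF \<alpha>] by fastforce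
  fix b b' assume "b \<in> snd ` \<alpha>" and le: "(b', b) \<in> le B"
  then obtain a where a: "(a, b) \<in> \<alpha>" by force
  then have "a \<in> carrier A" using ne_downsetsD(2)[OF \<alpha> a] by simp
  then have "(a, b') \<in> \<alpha>" using ne_downsetsD(3)[OF \<alpha> a, of "(a, b')"] le opas_refl[OF A] by simp
  then show "b' \<in> snd ` \<alpha>" by force
qed

lemma hull_in_ne_downsets:
  assumes A: "opas A" and B: "opas B" and \<alpha>: "\<alpha> \<in> ne_downsets (prod_opas A B)"
  shows "hull \<alpha> \<in> ne_downsets (prod_opas A B)"
proof -
  note f = image_fst_in_ne_downsets[OF assms] and s = image_snd_in_ne_downsets[OF assms]
  show ?thesis
    unfolding hull_def
  proof (rule ne_downsetsI)
    show "fst ` \<alpha> \<times> snd ` \<alpha> \<noteq> {}" using ne_downsetsD(1)[OF \<alpha>] by simp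
    show "fst ` \<alpha> \<times> snd ` \<alpha> \<subseteq> carrier (prod_opas A B)"
      unfolding prod_opas_simps by (intro Sigma_mono subsetI ne_downsetsD(2)[OF f] ne_downsetsD(2)[OF s])
  next
    fix x y assume "x \<in> fst ` \<alpha> \<times> snd ` \<alpha>" "(y, x) \<in> le (prod_opas A B)"
    then show "y \<in> fst ` \<alpha> \<times> snd ` \<alpha>"
      using ne_downsetsD(3)[OF f, of "fst x" "fst y"] ne_downsetsD(3)[OF s, of "snd x" "snd y"]
      unfolding mem_Times_iff prod_opas_simps by simp
  qed
qed

lemma test_downsets_subset_ne_downsets:
  assumes A: "opas A" and B: "opas B"
    and least: "\<And>z. z \<in> carrier (prod_opas A B) \<Longrightarrow>
      \<exists>a\<in>carrier (prod_opas A B). (z, a) \<notin> le (prod_opas A B)"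
  shows "\<alpha> \<in> test_downsets (prod_opas A B) \<Longrightarrow> \<alpha> \<in> ne_downsets (prod_opas A B)"
proof (induction rule: test_downsets.induct)
  case (principal a)
  then show ?case by (rule principal_in_ne_downsets[OF opas_prod[OF A B]])
next
  case (hull \<alpha>)
  show ?case by (rule hull_in_ne_downsets[OF A B hull.IH])
next
  case (avoiding \<alpha>)
  show ?case by (rule avoiding_in_ne_downsets[OF opas_prod[OF A B] least avoiding.IH])
next
  case (app \<alpha> \<beta> \<gamma>)
  show ?case by (rule T_app_closed[OF opas_prod[OF A B] app.IH app.hyps(3)])
qed

text \<open>Let \<open>x \<in> \<alpha>\<close>, and choose \<open>i\<close> and \<open>j\<close> not above the components of \<open>x\<close>. Then no pair \<open>(a, j)\<close> and no pair
  \<open>(i, b)\<close> is above \<open>x\<close>, and these pairs have full projections.\<close>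

lemma hull_avoiding:
  assumes A: "\<And>z. z \<in> carrier A \<Longrightarrow> \<exists>a\<in>carrier A. (z, a) \<notin> le A"
    and B: "\<And>z. z \<in> carrier B \<Longrightarrow> \<exists>b\<in>carrier B. (z, b) \<notin> le B"
    and \<alpha>: "\<alpha> \<in> ne_downsets (prod_opas A B)"
  shows "hull (avoiding (prod_opas A B) \<alpha>) = carrier (prod_opas A B)"
proof -
  obtain x where x: "x \<in> \<alpha>" using ne_downsetsD(1)[OF \<alpha>] by blast
  then have "x \<in> carrier (prod_opas A B)" using ne_downsetsD(2)[OF \<alpha>] by blast
  then have "fst x \<in> carrier A" "snd x \<in> carrier B" by auto
  then obtain i j where i: "i \<in> carrier A" "(fst x, i) \<notin> le A" and j: "j \<in> carrier B" "(snd x, j) \<notin> le B"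
    using A B by blast
  have "(a, j) \<in> avoiding (prod_opas A B) \<alpha>" if "a \<in> carrier A" for a
    using that x j by (auto simp: avoiding_def)
  moreover have "(i, b) \<in> avoiding (prod_opas A B) \<alpha>" if "b \<in> carrier B" for b
    using that x i by (auto simp: avoiding_def)
  ultimately have "carrier A \<subseteq> fst ` avoiding (prod_opas A B) \<alpha>"
    "carrier B \<subseteq> snd ` avoiding (prod_opas A B) \<alpha>"
    by force+
  then show ?thesis by (auto simp: hull_def avoiding_def)
qed

lemma hull_down:
  assumes A: "opas A" and B: "opas B" and S: "S \<subseteq> carrier (prod_opas A B)"
  shows "hull (down (prod_opas A B) S) = down (prod_opas A B) (hull S)"
proof (intro equalityI subsetI)
  fix x assume "x \<in> hull (down (prod_opas A B) S)"
  then obtain y z where y: "y \<in> down (prod_opas A B) S" "fst x = fst y"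
    and z: "z \<in> down (prod_opas A B) S" "snd x = snd z"
    unfolding hull_def mem_Times_iff by blast
  obtain s t where s: "s \<in> S" "(y, s) \<in> le (prod_opas A B)" and t: "t \<in> S" "(z, t) \<in> le (prod_opas A B)"
    using y(1) z(1) unfolding down_def by blast
  have "(fst s, snd t) \<in> hull S" using s(1) t(1) unfolding hull_def by blast
  moreover have "(x, (fst s, snd t)) \<in> le (prod_opas A B)"
    using s(2) t(2) y(2) z(2) by simp
  ultimately show "x \<in> down (prod_opas A B) (hull S)" unfolding down_def by blast
next
  fix x assume "x \<in> down (prod_opas A B) (hull S)"
  then obtain w where "w \<in> hull S" and w: "(x, w) \<in> le (prod_opas A B)"
    unfolding down_def by blast
  then obtain s t where s: "s \<in> S" "fst w = fst s" and t: "t \<in> S" "snd w = snd t"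
    unfolding hull_def mem_Times_iff by blast
  have "(fst x, snd s) \<in> down (prod_opas A B) S" "(fst t, snd x) \<in> down (prod_opas A B) S"
  proof -
    have "s \<in> carrier (prod_opas A B)" "t \<in> carrier (prod_opas A B)" using s(1) t(1) S by blast+
    then have "snd s \<in> carrier B" "fst t \<in> carrier A" by auto
    then have "((fst x, snd s), s) \<in> le (prod_opas A B)" "((fst t, snd x), t) \<in> le (prod_opas A B)"
      using w s(2) t(2) opas_refl[OF A] opas_refl[OF B] by simp_all
    then show "(fst x, snd s) \<in> down (prod_opas A B) S" "(fst t, snd x) \<in> down (prod_opas A B) S"
      using s(1) t(1) unfolding down_def by blast+
  qed
  then have "fst (fst x, snd s) \<in> fst ` down (prod_opas A B) S"
    "snd (fst t, snd x) \<in> snd ` down (prod_opas A B) S"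
    by (blast intro: imageI)+
  then show "x \<in> hull (down (prod_opas A B) S)"
    unfolding hull_def mem_Times_iff by simp
qed

text \<open>Application in a product is componentwise, so its domain and the projections of its value are determined
  by the projections of the arguments. Hence \<open>hull\<close> is a strict homomorphism, and precomposing with it preserves realizers.\<close>

lemma hull_app:
  assumes A: "opas A" and B: "opas B" and \<alpha>: "\<alpha> \<in> ne_downsets (prod_opas A B)"
    and \<beta>: "\<beta> \<in> ne_downsets (prod_opas A B)" and app: "app (T_opca (prod_opas A B)) \<alpha> \<beta> = Some \<gamma>"
  shows "app (T_opca (prod_opas A B)) (hull \<alpha>) (hull \<beta>) = Some (hull \<gamma>)"
proof -
  let ?P = "prod_opas A B"
  let ?S = "\<lambda>\<alpha> \<beta>. {c. \<exists>a\<in>\<alpha>. \<exists>b\<in>\<beta>. app ?P a b = Some c}"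
  have \<gamma>: "\<gamma> = down ?P (?S \<alpha> \<beta>)" and def: "\<And>a b. a \<in> \<alpha> \<Longrightarrow> b \<in> \<beta> \<Longrightarrow> \<exists>c. app ?P a b = Some c"
    using app unfolding T_app_eq_Some pdefined_def by auto
  have S: "?S \<alpha> \<beta> \<subseteq> carrier ?P"
    using opas_app_closed[OF opas_prod[OF A B]] ne_downsetsD(2)[OF \<alpha>] ne_downsetsD(2)[OF \<beta>] by blast
  have *: "\<exists>c. app ?P x y = Some c \<and> c \<in> hull (?S \<alpha> \<beta>)" if x: "x \<in> hull \<alpha>" and y: "y \<in> hull \<beta>" for x y
  proof -
    obtain a a' b b' where a: "a \<in> \<alpha>" "fst x = fst a" "a' \<in> \<alpha>" "snd x = snd a'"
      and b: "b \<in> \<beta>" "fst y = fst b" "b' \<in> \<beta>" "snd y = snd b'"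
      using x y unfolding hull_def mem_Times_iff by blast
    obtain c c' where c: "app ?P a b = Some c" "app ?P a' b' = Some c'"
      using def[OF a(1) b(1)] def[OF a(3) b(3)] by blast
    then have "app ?P x y = Some (fst c, snd c')" using a b by simp
    moreover have "c \<in> ?S \<alpha> \<beta>" "c' \<in> ?S \<alpha> \<beta>" using c a b by blast+
    then have "(fst c, snd c') \<in> hull (?S \<alpha> \<beta>)" unfolding hull_def by blast
    ultimately show ?thesis by blast
  qed
  have "hull (?S \<alpha> \<beta>) \<subseteq> ?S (hull \<alpha>) (hull \<beta>)"
  proof
    fix c assume "c \<in> hull (?S \<alpha> \<beta>)"
    then obtain d d' where d: "d \<in> ?S \<alpha> \<beta>" "d' \<in> ?S \<alpha> \<beta>" "fst c = fst d" "snd c = snd d'"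
      unfolding hull_def mem_Times_iff by blast
    then obtain a b a' b' where ab: "a \<in> \<alpha>" "b \<in> \<beta>" "app ?P a b = Some d"
      "a' \<in> \<alpha>" "b' \<in> \<beta>" "app ?P a' b' = Some d'" by blast
    have "app ?P (fst a, snd a') (fst b, snd b') = Some c" using ab d by simp
    moreover have "(fst a, snd a') \<in> hull \<alpha>" "(fst b, snd b') \<in> hull \<beta>"
      using ab unfolding hull_def by blast+
    ultimately show "c \<in> ?S (hull \<alpha>) (hull \<beta>)" by blast
  qed
  moreover have "?S (hull \<alpha>) (hull \<beta>) \<subseteq> hull (?S \<alpha> \<beta>)" using * by force
  ultimately have "hull \<gamma> = down ?P (?S (hull \<alpha>) (hull \<beta>))"
    unfolding \<gamma> hull_down[OF A B S] by (simp add: equalityI)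
  then show ?thesis
    using * unfolding T_app_eq_Some pdefined_def by blast
qed

lemma T_app_prod_components:
  assumes app: "app (T_opca (prod_opas A B)) \<alpha> \<beta> = Some \<gamma>"
    and A: "opas A" and B: "opas B" and \<alpha>: "\<alpha> \<in> ne_downsets (prod_opas A B)"
    and \<beta>: "\<beta> \<in> ne_downsets (prod_opas A B)"
  shows "x \<in> fst ` \<alpha> \<Longrightarrow> y \<in> fst ` \<beta> \<Longrightarrow> app_in A x y (fst ` \<gamma>)"
    and "x' \<in> snd ` \<alpha> \<Longrightarrow> y' \<in> snd ` \<beta> \<Longrightarrow> app_in B x' y' (snd ` \<gamma>)"
proof -
  let ?P = "prod_opas A B"
  note P = opas_prod[OF A B]
  have *: "app_in ?P a b \<gamma>" if "a \<in> \<alpha>" "b \<in> \<beta>" for a b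
    using T_app_le_iff[OF P \<alpha> \<beta> T_app_closed[OF P \<alpha> \<beta> app]] app that by blast
  show "app_in A x y (fst ` \<gamma>)" if xy: "x \<in> fst ` \<alpha>" "y \<in> fst ` \<beta>"
  proof -
    obtain a b where "a \<in> \<alpha>" "x = fst a" "b \<in> \<beta>" "y = fst b" using xy by blast
    then show ?thesis using *[of a b] by (fastforce simp: app_in_def intro: rev_image_eqI)
  qed
  show "app_in B x' y' (snd ` \<gamma>)" if xy: "x' \<in> snd ` \<alpha>" "y' \<in> snd ` \<beta>"
  proof -
    obtain a b where "a \<in> \<alpha>" "x' = snd a" "b \<in> \<beta>" "y' = snd b" using xy by blast
    then show ?thesis using *[of a b] by (fastforce simp: app_in_def intro: rev_image_eqI)
  qed
qed

section \<open>Two applicative morphisms with the same projections\<close>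

text \<open>For a monotone map that preserves application up to inclusion, the identity combinator realizes both
  conditions.\<close>

lemma pca_arrow_strict:
  assumes B: "opas (relabel \<iota> X D)" and C: "opca C" and inj: "inj_on \<iota> X"
    and closed: "\<And>x y z. x \<in> X \<Longrightarrow> y \<in> X \<Longrightarrow> app D x y = Some z \<Longrightarrow> z \<in> X"
    and F: "\<And>x. x \<in> X \<Longrightarrow> F x \<in> ne_downsets C"
    and mono: "\<And>x y. x \<in> X \<Longrightarrow> y \<in> X \<Longrightarrow> (y, x) \<in> le D \<Longrightarrow> F y \<subseteq> F x"
    and app: "\<And>x y z v w. x \<in> X \<Longrightarrow> y \<in> X \<Longrightarrow> app D x y = Some z \<Longrightarrow> v \<in> F x \<Longrightarrow> w \<in> F y \<Longrightarrow>
      app_in C v w (F z)"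
  shows "pca_arrow (relabel \<iota> X D) C (\<lambda>b. F (inv_into X \<iota> b))"
proof -
  note Co = opca_opas[OF C]
  obtain i where i: "i \<in> carrier C"
    and id: "\<And>x. x \<in> carrier C \<Longrightarrow> \<exists>y. app C i x = Some y \<and> (y, x) \<in> le C"
    by (rule opca_identity[OF C]) blast
  have app_i: "app2_in C i v w (F z)"
    if xyz: "x \<in> X" "y \<in> X" "app D x y = Some z" and v: "v \<in> F x" and w: "w \<in> F y" for x y z v w
  proof -
    obtain v' where v': "app C i v = Some v'" "(v', v) \<in> le C"
      using id[OF ne_downsetsD(2)[OF F[OF xyz(1)] v]] by blast
    have "app_in C v' w (F z)"
      by (rule app_in_mono[OF Co app[OF xyz v w] F[OF closed[OF xyz]] v'(2)
            opas_refl[OF Co ne_downsetsD(2)[OF F[OF xyz(2)] w]]])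
    then show ?thesis using v'(1) by (simp add: app2_in_def)
  qed
  have mono_i: "app_in C i v (F x)" if "x \<in> X" "y \<in> X" "(y, x) \<in> le D" "v \<in> F y" for x y v
  proof -
    have v: "v \<in> F x" using mono[OF that(1-3)] that(4) by blast
    then show ?thesis
      using id[OF ne_downsetsD(2)[OF F[OF that(1)] v]] ne_downsetsD(3)[OF F[OF that(1)] v]
      unfolding app_in_def by blast
  qed
  have inv: "F (inv_into X \<iota> (\<iota> x)) = F x" if "x \<in> X" for x
    using inv_into_f_f[OF inj that] by simp
  show ?thesis
    unfolding pca_arrow_relabel_iff[OF B Co inj]
  proof (intro conjI bexI[OF _ i] ballI allI impI)
    show "F (inv_into X \<iota> (\<iota> x)) \<in> ne_downsets C" if "x \<in> X" for x
      unfolding inv[OF that] by (rule F[OF that])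
    fix x y assume xy: "x \<in> X" "y \<in> X"
    show "app_in C i v (F (inv_into X \<iota> (\<iota> x)))"
      if "(y, x) \<in> le D" "v \<in> F (inv_into X \<iota> (\<iota> y))" for v
      using mono_i[OF xy that(1)] that(2) unfolding inv[OF xy(1)] inv[OF xy(2)] by blast
    fix z v w
    assume z: "app D x y = Some z"
      and "v \<in> F (inv_into X \<iota> (\<iota> x))" "w \<in> F (inv_into X \<iota> (\<iota> y))"
    then show "app2_in C i v w (F (inv_into X \<iota> (\<iota> z)))"
      using app_i[OF xy z] unfolding inv[OF xy(1)] inv[OF xy(2)] inv[OF closed[OF xy z]] by blast
  qed
qed

text \<open>The core of the comparison of \<open>g1\<close> with \<open>g2\<close> after projection, where \<open>S\<close> is the projection of \<open>q\<close>.
  The realizer \<open>r\<close> sends \<open>S (h x)\<close> into the image of \<open>h x\<close>, which is the image of \<open>x\<close>. So the value is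
  \<open>pr a\<close> for some \<open>a \<in> x\<close>, and it is also in the image of \<open>p a\<close>; from there \<open>r'\<close> leads to \<open>S (p a)\<close>.
  Thus \<open>r'\<close> after \<open>r\<close> works.\<close>

lemma realizer_through_principals:
  assumes A: "opca A" and r: "r \<in> carrier A" and r': "r' \<in> carrier A"
    and r_in: "\<And>x v. x \<in> X \<Longrightarrow> v \<in> S x \<Longrightarrow> app_in A r v (pr ` x)"
    and r'_in: "\<And>x v. x \<in> X \<Longrightarrow> v \<in> pr ` x \<Longrightarrow> app_in A r' v (S x)"
    and h: "\<And>x. x \<in> X \<Longrightarrow> h x \<in> X \<and> pr ` h x = pr ` x"
    and p: "\<And>x a. x \<in> X \<Longrightarrow> a \<in> x \<Longrightarrow> p a \<in> X \<and> a \<in> p a"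
    and down: "\<And>x. x \<in> X \<Longrightarrow> S x \<in> ne_downsets A"
  shows "\<exists>m\<in>carrier A. \<forall>x\<in>X. \<forall>v\<in>S (h x). app_in A m v (\<Union>a\<in>x. S (p a))"
proof -
  obtain m where m: "m \<in> carrier A" and comp: "\<And>v y z. v \<in> carrier A \<Longrightarrow> app A r v = Some y \<Longrightarrow>
      app A r' y = Some z \<Longrightarrow> \<exists>z'. app A m v = Some z' \<and> (z', z) \<in> le A"
    using opca_composite[OF A r r'] by blast
  have "app_in A m v (\<Union>a\<in>x. S (p a))" if x: "x \<in> X" and v: "v \<in> S (h x)" for x v
  proof -
    obtain a where a: "a \<in> x" "app A r v = Some (pr a)"
      using r_in[OF _ v] h[OF x] unfolding app_in_def by auto
    have pa: "p a \<in> X" "a \<in> p a" using p[OF x a(1)] by auto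
    then obtain z where z: "app A r' (pr a) = Some z" "z \<in> S (p a)"
      using r'_in[OF pa(1), of "pr a"] unfolding app_in_def by blast
    have "v \<in> carrier A" using ne_downsetsD(2)[OF down v] h[OF x] by blast
    then obtain z' where "app A m v = Some z'" "(z', z) \<in> le A"
      using comp a(2) z(1) by blast
    then show ?thesis
      using ne_downsetsD(3)[OF down[OF pa(1)] z(2)] a(1) unfolding app_in_def by blast
  qed
  then show ?thesis using m by blast
qed

text \<open>The realizer \<open>r\<close> of one half of the equivalence is returned as well, because it yields the lower bound
  in the final contradiction. The lemma serves both projections, with \<open>h = hull\<close> and \<open>p = principal P\<close>.\<close>

lemma projection_le_via_principals:
  fixes A :: "'a opas" and C :: "'c opas" and D :: "'d set opas" and \<sigma> :: "'c \<Rightarrow> 'a set"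
    and q g1 g2 :: "'u \<Rightarrow> 'c set" and pr :: "'d \<Rightarrow> 'a"
  assumes C: "opas C" and A: "opca A" and \<sigma>: "\<And>c. c \<in> carrier C \<Longrightarrow> \<sigma> c \<in> ne_downsets A"
    and inj: "inj_on \<iota> X" and q: "\<And>x. x \<in> X \<Longrightarrow> q (\<iota> x) \<in> ne_downsets C"
    and simeq: "pca_simeq (relabel \<iota> X D) A (pca_comp A \<sigma> q) (\<lambda>b. pr ` inv_into X \<iota> b)"
    and pr: "\<And>x. x \<in> X \<Longrightarrow> pr ` x \<in> ne_downsets A"
    and h: "\<And>x. x \<in> X \<Longrightarrow> h x \<in> X \<and> pr ` h x = pr ` x"
    and p: "\<And>x a. x \<in> X \<Longrightarrow> a \<in> x \<Longrightarrow> p a \<in> X \<and> a \<in> p a"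
    and g1: "\<And>x. x \<in> X \<Longrightarrow> g1 (\<iota> x) = q (\<iota> (h x))"
    and g2: "\<And>x. x \<in> X \<Longrightarrow> g2 (\<iota> x) = (\<Union>a\<in>x. q (\<iota> (p a)))"
    and g1X: "\<And>x. x \<in> X \<Longrightarrow> g1 (\<iota> x) \<in> ne_downsets C"
    and g2X: "\<And>x. x \<in> X \<Longrightarrow> g2 (\<iota> x) \<in> ne_downsets C"
  obtains r where "r \<in> carrier A"
    and "\<And>x c v. x \<in> X \<Longrightarrow> c \<in> q (\<iota> x) \<Longrightarrow> v \<in> \<sigma> c \<Longrightarrow> app_in A r v (pr ` x)"
    and "pca_le (relabel \<iota> X D) A (pca_comp A \<sigma> g1) (pca_comp A \<sigma> g2)"
proof -
  note Ao = opca_opas[OF A]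
  define S where "S x = (\<Union>c\<in>q (\<iota> x). \<sigma> c)" for x
  have comp: "pca_comp A \<sigma> g b = (\<Union>c\<in>g b. \<sigma> c) \<and> (\<Union>c\<in>g b. \<sigma> c) \<in> ne_downsets A"
    if g: "g b \<in> ne_downsets C" for g :: "'u \<Rightarrow> 'c set" and b
  proof -
    have "\<sigma> c \<in> ne_downsets A" if "c \<in> g b" for c using \<sigma>[OF ne_downsetsD(2)[OF g that]] .
    then show ?thesis
      using pca_comp_eq_Union[of g b \<sigma> A] Union_in_ne_downsets[of "g b" \<sigma> A] ne_downsetsD(1)[OF g]
      by blast
  qed
  have S: "pca_comp A \<sigma> q (\<iota> x) = S x" "S x \<in> ne_downsets A" if "x \<in> X" for x
    using comp[of q "\<iota> x", OF q[OF that]] by (auto simp: S_def)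
  have f: "pr ` inv_into X \<iota> (\<iota> x) = pr ` x" if "x \<in> X" for x
    using that by (simp add: inv_into_f_f[OF inj])
  have "pca_le (relabel \<iota> X D) A (pca_comp A \<sigma> q) (\<lambda>b. pr ` inv_into X \<iota> b)"
    using simeq by (simp add: pca_simeq_def)
  then have "\<exists>r\<in>carrier A. \<forall>x\<in>X. \<forall>v\<in>S x. app_in A r v (pr ` x)"
    by (subst (asm) pca_le_relabel_iff[OF Ao inj]) (simp_all add: S f pr cong: ball_cong)
  then obtain r where r: "r \<in> carrier A" "\<And>x v. x \<in> X \<Longrightarrow> v \<in> S x \<Longrightarrow> app_in A r v (pr ` x)"
    by blast
  have "pca_le (relabel \<iota> X D) A (\<lambda>b. pr ` inv_into X \<iota> b) (pca_comp A \<sigma> q)"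
    using simeq by (simp add: pca_simeq_def)
  then have "\<exists>r\<in>carrier A. \<forall>x\<in>X. \<forall>v\<in>pr ` x. app_in A r v (S x)"
    by (subst (asm) pca_le_relabel_iff[OF Ao inj]) (simp_all add: S f pr cong: ball_cong)
  then obtain r' where r': "r' \<in> carrier A" "\<And>x v. x \<in> X \<Longrightarrow> v \<in> pr ` x \<Longrightarrow> app_in A r' v (S x)"
    by blast
  have m: "\<exists>m\<in>carrier A. \<forall>x\<in>X. \<forall>v\<in>S (h x). app_in A m v (\<Union>a\<in>x. S (p a))"
    by (rule realizer_through_principals[OF A r(1) r'(1) r(2) r'(2) h p S(2)])
  have "pca_comp A \<sigma> g1 (\<iota> x) = S (h x)" "pca_comp A \<sigma> g1 (\<iota> x) \<in> ne_downsets A" if "x \<in> X" for x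
    using comp[of g1 "\<iota> x", OF g1X[OF that]] g1[OF that] by (simp_all add: S_def)
  moreover have "pca_comp A \<sigma> g2 (\<iota> x) = (\<Union>a\<in>x. S (p a))" "pca_comp A \<sigma> g2 (\<iota> x) \<in> ne_downsets A"
    if "x \<in> X" for x
    using comp[of g2 "\<iota> x", OF g2X[OF that]] g2[OF that] by (auto simp: S_def)
  ultimately have "pca_le (relabel \<iota> X D) A (pca_comp A \<sigma> g1) (pca_comp A \<sigma> g2)"
    using m by (subst pca_le_relabel_iff[OF Ao inj]) (simp_all cong: ball_cong)
  then show ?thesis
    using that r unfolding S_def by blast
qed

lemma no_pseudoproduct_without_least:
  fixes A0 A1 :: "'u opas"
  assumes inf: "infinite (UNIV :: 'u set)" and A0: "opca A0" and A1: "opca A1"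
    and prod: "has_pseudoproduct A0 A1"
    and least0: "\<And>z. z \<in> carrier A0 \<Longrightarrow> \<exists>a\<in>carrier A0. (z, a) \<notin> le A0"
    and least1: "\<And>z. z \<in> carrier A1 \<Longrightarrow> \<exists>a\<in>carrier A1. (z, a) \<notin> le A1"
  shows False
proof -
  obtain C \<sigma>0 \<sigma>1 where pp: "is_pseudoproduct A0 A1 C \<sigma>0 \<sigma>1"
    using prod unfolding has_pseudoproduct_def by blast
  then have Cc: "opca C" and \<sigma>: "pca_arrow C A0 \<sigma>0" "pca_arrow C A1 \<sigma>1"
    by (auto simp: is_pseudoproduct_def)
  note C = opca_opas[OF Cc] and O0 = opca_opas[OF A0] and O1 = opca_opas[OF A1]
  have \<sigma>0: "\<And>c. c \<in> carrier C \<Longrightarrow> \<sigma>0 c \<in> ne_downsets A0"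
    using \<sigma>(1) unfolding pca_arrow_iff[OF C O0] by blast
  have \<sigma>1: "\<And>c. c \<in> carrier C \<Longrightarrow> \<sigma>1 c \<in> ne_downsets A1"
    using \<sigma>(2) unfolding pca_arrow_iff[OF C O1] by blast
  define P where "P = prod_opas A0 A1"
  define X where "X = test_downsets P"
  have P: "opas P" unfolding P_def by (rule opas_prod[OF O0 O1])
  have leastP: "\<exists>a\<in>carrier P. (z, a) \<notin> le P" if z: "z \<in> carrier P" for z
  proof -
    have "fst z \<in> carrier A0" "snd z \<in> carrier A1" using z by (auto simp: P_def)
    then obtain a where "a \<in> carrier A0" "(fst z, a) \<notin> le A0" using least0 by blast
    then have "(a, snd z) \<in> carrier P" "(z, (a, snd z)) \<notin> le P"
      using \<open>snd z \<in> carrier A1\<close> by (simp_all add: P_def)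
    then show ?thesis by blast
  qed
  have XP: "\<And>x. x \<in> X \<Longrightarrow> x \<in> ne_downsets P"
    using test_downsets_subset_ne_downsets[OF O0 O1] leastP unfolding X_def P_def by blast
  have closed: "\<And>x y z. x \<in> X \<Longrightarrow> y \<in> X \<Longrightarrow> app (T_opca P) x y = Some z \<Longrightarrow> z \<in> X"
    unfolding X_def by (rule test_downsets.app)
  have hullX: "\<And>x. x \<in> X \<Longrightarrow> hull x \<in> X"
    unfolding X_def by (rule test_downsets.hull)
  have pX: "\<And>a. a \<in> carrier P \<Longrightarrow> principal P a \<in> X"
    unfolding X_def by (rule test_downsets.principal)
  have pX': "principal P a \<in> X \<and> a \<in> principal P a" if "x \<in> X" "a \<in> x" for x a
    using pX mem_principal[OF P] ne_downsetsD(2)[OF XP[OF that(1)] that(2)] by blast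
  obtain \<iota> :: "('u \<times> 'u) set \<Rightarrow> 'u" where inj: "inj_on \<iota> X"
    using ex_inj_on_test_downsets[OF inf] unfolding X_def by blast
  note inv[simp] = inv_into_f_f[OF inj]
  define B where "B = relabel \<iota> X (T_opca P)"
  have XD: "X \<subseteq> carrier (T_opca P)" using XP by auto
  have Bo: "opas (relabel \<iota> X (T_opca P))"
    using closed by (rule opas_relabel[OF opas_T[OF P] inj XD])
  have B: "opca B"
  proof -
    obtain k s k' s' where "combinators A0 k s" "combinators A1 k' s'"
      using A0 A1 unfolding opca_iff_combinators by blast
    then have ks: "combinators P (k, k') (s, s')"
      unfolding P_def by (rule combinators_prod)
    then have c: "(k, k') \<in> carrier P" "(s, s') \<in> carrier P" by (auto simp: combinators_def)
    have "combinators B (\<iota> (principal P (k, k'))) (\<iota> (principal P (s, s')))"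
      unfolding B_def using closed
      by (rule combinators_relabel[OF combinators_T[OF P ks] inj XD _ pX[OF c(1)] pX[OF c(2)]])
    then show ?thesis using Bo unfolding opca_iff_combinators B_def by blast
  qed
  have app_fst: "app_in A0 v w (fst ` z)"
    if "x \<in> X" "y \<in> X" "app (T_opca P) x y = Some z" "v \<in> fst ` x" "w \<in> fst ` y" for x y z v w
    using T_app_prod_components(1)[OF _ O0 O1] that XP unfolding P_def by blast
  have app_snd: "app_in A1 v w (snd ` z)"
    if "x \<in> X" "y \<in> X" "app (T_opca P) x y = Some z" "v \<in> snd ` x" "w \<in> snd ` y" for x y z v w
    using T_app_prod_components(2)[OF _ O0 O1] that XP unfolding P_def by blast
  have fstX: "\<And>x. x \<in> X \<Longrightarrow> fst ` x \<in> ne_downsets A0"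
    using image_fst_in_ne_downsets[OF O0 O1] XP unfolding P_def by blast
  have sndX: "\<And>x. x \<in> X \<Longrightarrow> snd ` x \<in> ne_downsets A1"
    using image_snd_in_ne_downsets[OF O0 O1] XP unfolding P_def by blast
  let ?f0 = "\<lambda>b. fst ` inv_into X \<iota> b" and ?f1 = "\<lambda>b. snd ` inv_into X \<iota> b"
  have f0: "pca_arrow B A0 ?f0"
    unfolding B_def
    by (rule pca_arrow_strict[OF Bo A0 inj closed fstX _ app_fst]) auto
  have f1: "pca_arrow B A1 ?f1"
    unfolding B_def
    by (rule pca_arrow_strict[OF Bo A1 inj closed sndX _ app_snd]) auto
  obtain q where q: "pca_arrow B C q"
    and q0: "pca_simeq B A0 (pca_comp A0 \<sigma>0 q) ?f0" and q1: "pca_simeq B A1 (pca_comp A1 \<sigma>1 q) ?f1"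
    using pp B f0 f1 unfolding is_pseudoproduct_def by blast
  \<comment> \<open>The morphism \<open>g1\<close> depends only on the rectangle \<open>hull \<alpha>\<close>, whereas \<open>g2\<close> depends on the elements of \<open>\<alpha>\<close>.\<close>
  define g1 where "g1 = (\<lambda>b. q (\<iota> (hull (inv_into X \<iota> b))))"
  define g2 where "g2 = (\<lambda>b. \<Union>a\<in>inv_into X \<iota> b. q (\<iota> (principal P a)))"
  have g1_eq: "g1 (\<iota> x) = q (\<iota> (hull x))" if "x \<in> X" for x
    using that by (simp add: g1_def)
  have g2_eq: "g2 (\<iota> x) = (\<Union>a\<in>x. q (\<iota> (principal P a)))" if "x \<in> X" for x
    using that by (simp add: g2_def)
  note arrow_iff = pca_arrow_relabel_iff[OF Bo C inj, folded B_def]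
  have qX: "\<And>x. x \<in> X \<Longrightarrow> q (\<iota> x) \<in> ne_downsets C"
    using q unfolding arrow_iff by blast
  obtain t where t: "t \<in> carrier C" "\<And>x y z v w. x \<in> X \<Longrightarrow> y \<in> X \<Longrightarrow> app (T_opca P) x y = Some z \<Longrightarrow>
      v \<in> q (\<iota> x) \<Longrightarrow> w \<in> q (\<iota> y) \<Longrightarrow> app2_in C t v w (q (\<iota> z))"
    using q unfolding arrow_iff by blast
  obtain u where u: "u \<in> carrier C" "\<And>x y v. x \<in> X \<Longrightarrow> y \<in> X \<Longrightarrow> (y, x) \<in> le (T_opca P) \<Longrightarrow>
      v \<in> q (\<iota> y) \<Longrightarrow> app_in C u v (q (\<iota> x))"
    using q unfolding arrow_iff by blast
  have g1X: "g1 (\<iota> x) \<in> ne_downsets C" if "x \<in> X" for x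
    unfolding g1_eq[OF that] by (rule qX[OF hullX[OF that]])
  have g2X: "g2 (\<iota> x) \<in> ne_downsets C" if "x \<in> X" for x
    unfolding g2_eq[OF that]
    using qX pX'[OF that] ne_downsetsD(1)[OF XP[OF that]] by (intro Union_in_ne_downsets) blast+
  have g1: "pca_arrow B C g1"
    unfolding arrow_iff
  proof (intro conjI ballI)
    show "g1 (\<iota> x) \<in> ne_downsets C" if "x \<in> X" for x using g1X[OF that] .
    show "\<exists>t\<in>carrier C. \<forall>x\<in>X. \<forall>y\<in>X. \<forall>z. app (T_opca P) x y = Some z \<longrightarrow>
       (\<forall>v\<in>g1 (\<iota> x). \<forall>w\<in>g1 (\<iota> y). app2_in C t v w (g1 (\<iota> z)))"
    proof (intro bexI[OF _ t(1)] ballI allI impI)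
      fix x y z v w
      assume xyz: "x \<in> X" "y \<in> X" "app (T_opca P) x y = Some z"
        and v: "v \<in> g1 (\<iota> x)" and w: "w \<in> g1 (\<iota> y)"
      have "app (T_opca P) (hull x) (hull y) = Some (hull z)"
        using hull_app[OF O0 O1] XP xyz unfolding P_def by blast
      then show "app2_in C t v w (g1 (\<iota> z))"
        using t(2)[OF hullX[OF xyz(1)] hullX[OF xyz(2)]] v w
        unfolding g1_eq[OF xyz(1)] g1_eq[OF xyz(2)] g1_eq[OF closed[OF xyz]] by blast
    qed
    show "\<exists>u\<in>carrier C. \<forall>x\<in>X. \<forall>y\<in>X. (y, x) \<in> le (T_opca P) \<longrightarrow>
        (\<forall>v\<in>g1 (\<iota> y). app_in C u v (g1 (\<iota> x)))"
    proof (intro bexI[OF _ u(1)] ballI impI)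
      fix x y v
      assume xy: "x \<in> X" "y \<in> X" and le: "(y, x) \<in> le (T_opca P)" and v: "v \<in> g1 (\<iota> y)"
      have "hull y \<subseteq> hull x" using le by (auto simp: hull_def)
      then have "(hull y, hull x) \<in> le (T_opca P)"
        using XP[OF hullX[OF xy(1)]] XP[OF hullX[OF xy(2)]] by simp
      then show "app_in C u v (g1 (\<iota> x))"
        using u(2)[OF hullX[OF xy(1)] hullX[OF xy(2)]] v
        unfolding g1_eq[OF xy(1)] g1_eq[OF xy(2)] by blast
    qed
  qed
  have g2: "pca_arrow B C g2"
    unfolding arrow_iff
  proof (intro conjI ballI)
    show "g2 (\<iota> x) \<in> ne_downsets C" if "x \<in> X" for x using g2X[OF that] .
    show "\<exists>t\<in>carrier C. \<forall>x\<in>X. \<forall>y\<in>X. \<forall>z. app (T_opca P) x y = Some z \<longrightarrow>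
       (\<forall>v\<in>g2 (\<iota> x). \<forall>w\<in>g2 (\<iota> y). app2_in C t v w (g2 (\<iota> z)))"
    proof (intro bexI[OF _ t(1)] ballI allI impI)
      fix x y z v w
      assume xyz: "x \<in> X" "y \<in> X" "app (T_opca P) x y = Some z"
        and v: "v \<in> g2 (\<iota> x)" and w: "w \<in> g2 (\<iota> y)"
      have z: "z \<in> X" using closed[OF xyz] .
      obtain a where a: "a \<in> x" "v \<in> q (\<iota> (principal P a))" using v g2_eq[OF xyz(1)] by blast
      obtain b where b: "b \<in> y" "w \<in> q (\<iota> (principal P b))" using w g2_eq[OF xyz(2)] by blast
      have ab: "a \<in> carrier P" "b \<in> carrier P"
        using ne_downsetsD(2)[OF XP] xyz a(1) b(1) by blast+
      obtain c where c: "app P a b = Some c" "c \<in> z"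
        using T_app_le_iff[OF P XP[OF xyz(1)] XP[OF xyz(2)] XP[OF z]] xyz(3) a(1) b(1)
        unfolding app_in_def by blast
      \<comment> \<open>The product of two principal downsets is principal, so the tracker of \<open>q\<close> also tracks \<open>g2\<close>.\<close>
      have "app2_in C t v w (q (\<iota> (principal P c)))"
        using t(2)[OF pX[OF ab(1)] pX[OF ab(2)] T_app_principal[OF P ab c(1)] a(2) b(2)] .
      then show "app2_in C t v w (g2 (\<iota> z))"
        unfolding g2_eq[OF z] by (rule app2_in_weaken) (use c(2) in blast)
    qed
    show "\<exists>u\<in>carrier C. \<forall>x\<in>X. \<forall>y\<in>X. (y, x) \<in> le (T_opca P) \<longrightarrow>
        (\<forall>v\<in>g2 (\<iota> y). app_in C u v (g2 (\<iota> x)))"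
    proof (intro bexI[OF _ u(1)] ballI impI)
      fix x y v
      assume xy: "x \<in> X" "y \<in> X" and le: "(y, x) \<in> le (T_opca P)" and v: "v \<in> g2 (\<iota> y)"
      obtain a where a: "a \<in> y" "v \<in> q (\<iota> (principal P a))" using v g2_eq[OF xy(2)] by blast
      have pa: "principal P a \<in> X" using pX' xy(2) a(1) by blast
      have "(principal P a, principal P a) \<in> le (T_opca P)" using XP[OF pa] by simp
      then have "app_in C u v (q (\<iota> (principal P a)))" using u(2)[OF pa pa] a(2) by blast
      moreover have "a \<in> x" using le a(1) by auto
      ultimately show "app_in C u v (g2 (\<iota> x))"
        unfolding g2_eq[OF xy(1)] by (elim app_in_weaken) blast
    qed
  qed
  obtain r0 where r0: "r0 \<in> carrier A0"
    "\<And>x c v. x \<in> X \<Longrightarrow> c \<in> q (\<iota> x) \<Longrightarrow> v \<in> \<sigma>0 c \<Longrightarrow> app_in A0 r0 v (fst ` x)"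
    and le0: "pca_le B A0 (pca_comp A0 \<sigma>0 g1) (pca_comp A0 \<sigma>0 g2)"
    unfolding B_def
    by (rule projection_le_via_principals[where pr = fst and h = hull and p = "principal P",
          OF C A0 \<sigma>0 inj qX q0[unfolded B_def] fstX _ pX' g1_eq g2_eq g1X g2X])
      (simp_all add: hullX fst_hull)
  obtain r1 where r1: "r1 \<in> carrier A1"
    "\<And>x c v. x \<in> X \<Longrightarrow> c \<in> q (\<iota> x) \<Longrightarrow> v \<in> \<sigma>1 c \<Longrightarrow> app_in A1 r1 v (snd ` x)"
    and le1: "pca_le B A1 (pca_comp A1 \<sigma>1 g1) (pca_comp A1 \<sigma>1 g2)"
    unfolding B_def
    by (rule projection_le_via_principals[where pr = snd and h = hull and p = "principal P",
          OF C A1 \<sigma>1 inj qX q1[unfolded B_def] sndX _ pX' g1_eq g2_eq g1X g2X])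
      (simp_all add: hullX snd_hull)
  have "pca_le B C g1 g2"
    using pp B g1 g2 le0 le1 unfolding is_pseudoproduct_def by blast
  then obtain w where w: "w \<in> carrier C" "\<And>x v. x \<in> X \<Longrightarrow> v \<in> g1 (\<iota> x) \<Longrightarrow> app_in C w v (g2 (\<iota> x))"
    unfolding B_def using pca_le_relabel_iff[of C \<iota> X g1 g2, OF C inj g1X g2X] by blast
  have avoid: "avoiding P (principal P a) \<in> X" "hull (avoiding P (principal P a)) = carrier P"
    if "a \<in> carrier P" for a
    using test_downsets.avoiding pX[OF that] hull_avoiding[OF least0 least1] XP
    unfolding X_def P_def by blast+
  obtain a0 where a0: "a0 \<in> carrier P"
  proof -
    obtain k where "k \<in> carrier A0" by (rule opca_K[OF A0])
    moreover obtain k' where "k' \<in> carrier A1" by (rule opca_K[OF A1])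
    ultimately have "(k, k') \<in> carrier P" by (simp add: P_def)
    then show ?thesis using that by blast
  qed
  \<comment> \<open>The sets \<open>avoiding P (principal P d)\<close> all have the hull \<open>carrier P\<close>, so a single \<open>e\<close> serves for all of them.\<close>
  have "carrier P \<in> X" using hullX[OF avoid(1)[OF a0]] avoid(2)[OF a0] by simp
  then obtain e where e: "e \<in> q (\<iota> (carrier P))" using ne_downsetsD(1)[OF qX] by blast
  have ex_a: "\<exists>a\<in>avoiding P (principal P d). app_in C w e (q (\<iota> (principal P a)))"
    if d: "d \<in> carrier P" for d
    using w(2)[OF avoid(1)[OF d], of e] e
    unfolding g1_eq[OF avoid(1)[OF d]] g2_eq[OF avoid(1)[OF d]] avoid(2)[OF d] app_in_def by blast
  obtain e' where e': "app C w e = Some e'" using ex_a[OF a0] unfolding app_in_def by blast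
  have e'_in: "\<exists>a\<in>avoiding P (principal P d). e' \<in> q (\<iota> (principal P a))" if "d \<in> carrier P" for d
    using ex_a[OF that] e' unfolding app_in_def by auto
  obtain a1 where a1: "a1 \<in> carrier P" "e' \<in> q (\<iota> (principal P a1))"
    using e'_in[OF a0] unfolding avoiding_def by blast
  have e'C: "e' \<in> carrier C" using ne_downsetsD(2)[OF qX[OF pX[OF a1(1)]] a1(2)] .
  obtain c0 c1 where c0: "c0 \<in> \<sigma>0 e'" and c1: "c1 \<in> \<sigma>1 e'"
    using ne_downsetsD(1)[OF \<sigma>0[OF e'C]] ne_downsetsD(1)[OF \<sigma>1[OF e'C]] by blast
  have below: "app_in A0 r0 c0 (fst ` principal P a)" "app_in A1 r1 c1 (snd ` principal P a)"
    if "a \<in> carrier P" "e' \<in> q (\<iota> (principal P a))" for a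
    using r0(2)[OF pX[OF that(1)] that(2) c0] r1(2)[OF pX[OF that(1)] that(2) c1] .
  obtain y0 y1 where y: "app A0 r0 c0 = Some y0" "app A1 r1 c1 = Some y1"
    using below[OF a1] unfolding app_in_def by blast
  \<comment> \<open>The values \<open>y0\<close> and \<open>y1\<close> depend on \<open>e'\<close> only, not on \<open>a\<close>.\<close>
  have y_le: "((y0, y1), a) \<in> le P" if "a \<in> carrier P" "e' \<in> q (\<iota> (principal P a))" for a
    using below[OF that] y unfolding app_in_def principal_def P_def by auto
  have "(y0, y1) \<in> carrier P" using opas_le_carrier(1)[OF P y_le[OF a1]] .
  then obtain a where a: "a \<in> avoiding P (principal P (y0, y1))" "e' \<in> q (\<iota> (principal P a))"
    using e'_in by blast
  then have "a \<in> carrier P" by (simp add: avoiding_def)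
  then have "((y0, y1), a) \<in> le P" using y_le a(2) by blast
  then show False
    using a(1) opas_trans[OF P] unfolding avoiding_def principal_def by blast
qed

theorem theorem5p4:
  fixes A0 A1 :: "'u opas"
  assumes "opca A0" and "opca A1"
    and "has_pseudoproduct A0 A1"
  shows "trivial_opca A0 \<or> trivial_opca A1"
proof (rule ccontr)
  assume "\<not> (trivial_opca A0 \<or> trivial_opca A1)"
  then have least0: "\<And>z. z \<in> carrier A0 \<Longrightarrow> \<exists>a\<in>carrier A0. (z, a) \<notin> le A0"
    and least1: "\<And>z. z \<in> carrier A1 \<Longrightarrow> \<exists>a\<in>carrier A1. (z, a) \<notin> le A1"
    using trivial_opca_if_least[OF assms(1)] trivial_opca_if_least[OF assms(2)] by blast+
  have "infinite (carrier A0)"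
    using finite_opca_has_least[OF assms(1)] least0 by blast
  then have "infinite (UNIV :: 'u set)"
    using finite_subset[OF subset_UNIV] by blast
  then show False
    using no_pseudoproduct_without_least[OF _ assms least0 least1] by blast
qed

end
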